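(* A division ring $D$ is weakly locally finite if and only if $D$, regarded as an algebra over its center $F$, is locally PI.
   Context: A division ring is centrally finite if it is finite dimensional as a vector space over its own center. A division ring $D$ is weakly locally finite if for every finite subset $S\subseteq D$, the division subring of $D$ generated by $S$ is centrally finite (i.e. finite dimensional over its own center). An algebra $A$ over a field $k$ is locally PI if every finitely generated $k$-subalgebra of $A$ satisfies a polynomial identity. *)

theory Defs
  imports Main
begin

definition center_of :: "'a::ring_1 set \<Rightarrow> 'a set" where
  "center_of K = {z \<in> K. \<forall>x\<in>K. z * x = x * z}"

definition division_subring :: "'a::division_ring set \<Rightarrow> bool" where
  "division_subring K \<longleftrightarrow> 0 \<in> K \<and> 1 \<in> K \<and>
     (\<forall>x\<in>K. \<forall>y\<in>K. x + y \<in> K \<and> x * y \<in> K) \<and> (\<forall>x\<in>K. - x \<in> K) \<and>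
     (\<forall>x\<in>K. x \<noteq> 0 \<longrightarrow> inverse x \<in> K)"

definition division_subring_gen :: "'a::division_ring set \<Rightarrow> 'a set" where
  "division_subring_gen S = \<Inter>{K. division_subring K \<and> S \<subseteq> K}"

definition centrally_finite :: "'a::division_ring set \<Rightarrow> bool" where
  "centrally_finite K \<longleftrightarrow> (\<exists>B. finite B \<and> B \<subseteq> K \<and>
     (\<forall>x\<in>K. \<exists>c. (\<forall>b\<in>B. c b \<in> center_of K) \<and> x = (\<Sum>b\<in>B. c b * b)))"

definition weakly_locally_finite :: "'a::division_ring itself \<Rightarrow> bool" where
  "weakly_locally_finite (_::'a itself) \<longleftrightarrow>
     (\<forall>S::'a set. finite S \<longrightarrow> centrally_finite (division_subring_gen S))"

text \<open>Noncommutative polynomials in variables x_0, x_1, ... with coefficients in F: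
  finitely supported functions from words (lists of variable indices) to F.\<close>
definition is_ncpoly :: "'a::ring_1 set \<Rightarrow> (nat list \<Rightarrow> 'a) \<Rightarrow> bool" where
  "is_ncpoly F p \<longleftrightarrow> finite {w. p w \<noteq> 0} \<and> (\<forall>w. p w \<in> F)"

definition ncpoly_eval :: "(nat list \<Rightarrow> 'a::ring_1) \<Rightarrow> (nat \<Rightarrow> 'a) \<Rightarrow> 'a" where
  "ncpoly_eval p a = (\<Sum>w\<in>{w. p w \<noteq> 0}. p w * prod_list (map a w))"

definition satisfies_PI :: "'a::ring_1 set \<Rightarrow> 'a set \<Rightarrow> bool" where
  "satisfies_PI F A \<longleftrightarrow> (\<exists>p. is_ncpoly F p \<and> (\<exists>w. p w \<noteq> 0) \<and>
     (\<forall>a. (\<forall>i. a i \<in> A) \<longrightarrow> ncpoly_eval p a = 0))"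

definition subalg_gen :: "'a::ring_1 set \<Rightarrow> 'a set \<Rightarrow> 'a set" where
  "subalg_gen F S = \<Inter>{A. F \<subseteq> A \<and> S \<subseteq> A \<and> (\<forall>x\<in>A. \<forall>y\<in>A. x + y \<in> A \<and> x * y \<in> A)}"

definition locally_PI :: "'a::division_ring itself \<Rightarrow> bool" where
  "locally_PI (_::'a itself) \<longleftrightarrow>
     (\<forall>S::'a set. finite S \<longrightarrow>
        satisfies_PI (center_of UNIV) (subalg_gen (center_of UNIV) S))"

end

theory Submission
  imports Defs "HOL-Library.Function_Algebras" "HOL-Combinatorics.Permutations"
    "HOL-Combinatorics.Multiset_Permutations"
begin

text \<open>If the division ring \<open>K\<close> generated by \<open>S\<close> has dimension \<open>n\<close> over its center, then
  \<open>F[S]\<close> lies in \<open>F K\<close>, which is spanned by \<open>n\<close> elements with coefficients that commute with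
  everything in sight, so it satisfies the standard identity of degree \<open>n + 1\<close>.

  Conversely, let a domain \<open>A\<close> with a multilinear identity generate the division ring \<open>K\<close>.
  If \<open>a A \<inter> b A = 0\<close>, the elements \<open>b\<^sup>i a\<close> would satisfy no identity; hence \<open>A\<close> is a right
  Ore domain and \<open>K\<close> consists of fractions. Let \<open>L\<close> be a maximal subfield of \<open>K\<close>. The identity
  extends to \<open>L \<otimes> A\<close> acting on \<open>K\<close> by \<open>x \<mapsto> l x a\<close>. By density, and after clearing
  denominators, this action contains enough maps to isolate a single monomial of the identity if
  \<open>K\<close> is infinite dimensional over \<open>L\<close>. So \<open>K\<close> is finite dimensional over \<open>L\<close>, and then over
  its center. This applies to \<open>A = F[S]\<close> and, since the division ring generated by \<open>F \<union> S\<close> then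
  satisfies a standard identity, also to the division ring generated by \<open>S\<close> alone.\<close>

section \<open>Additive closures\<close>

text \<open>Also applied to sets of maps, under pointwise addition. Spans and images of tensor
  products are additive closures of sets of products, the scalars being absorbed into the
  products.\<close>

inductive_set addcl :: "'b::comm_monoid_add set \<Rightarrow> 'b set" for X where
  addcl_zero: "0 \<in> addcl X"
| addcl_base: "x \<in> X \<Longrightarrow> x \<in> addcl X"
| addcl_add: "x \<in> addcl X \<Longrightarrow> y \<in> addcl X \<Longrightarrow> x + y \<in> addcl X"

lemma addcl_mono: "X \<subseteq> Y \<Longrightarrow> addcl X \<subseteq> addcl Y"
proof
  fix x assume "X \<subseteq> Y" "x \<in> addcl X"
  show "x \<in> addcl Y"
    using \<open>x \<in> addcl X\<close> \<open>X \<subseteq> Y\<close> by induction (auto intro: addcl.intros)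
qed

lemma addcl_sum: "(\<And>i. i \<in> I \<Longrightarrow> f i \<in> addcl X) \<Longrightarrow> sum f I \<in> addcl X"
  by (induction I rule: infinite_finite_induct) (auto intro: addcl.intros)

lemma addcl_additive_image:
  assumes "x \<in> addcl X" and "h 0 = 0" and "\<And>x y. h (x + y) = h x + h y"
    and "\<And>x. x \<in> X \<Longrightarrow> h x \<in> addcl Y"
  shows "h x \<in> addcl Y"
  using assms(1) by induction (auto simp: assms intro: addcl.intros)

lemma addcl_subset:
  assumes "0 \<in> M" and "\<And>x y. x \<in> M \<Longrightarrow> y \<in> M \<Longrightarrow> x + y \<in> M" and "X \<subseteq> M"
  shows "addcl X \<subseteq> M"
proof
  fix x assume "x \<in> addcl X"
  then show "x \<in> M" by induction (use assms in auto)
qed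

lemma addcl_mult_closed:
  fixes X :: "'a::ring set"
  assumes "\<And>x y. x \<in> X \<Longrightarrow> y \<in> X \<Longrightarrow> x * y \<in> addcl X"
    and "x \<in> addcl X" and "y \<in> addcl X"
  shows "x * y \<in> addcl X"
  using assms(2)
proof (rule addcl_additive_image)
  fix x assume "x \<in> X"
  show "x * y \<in> addcl X"
    by (rule addcl_additive_image[OF assms(3)])
       (auto simp: distrib_left intro: assms(1)[OF \<open>x \<in> X\<close>])
qed (auto simp: distrib_right)

text \<open>Additivity of \<open>g\<close> in its first argument merges all summands that belong to
  the same \<open>b\<close>. This gives coordinates in a span, and also one coefficient per right
  factor for sums of maps \<open>y \<mapsto> k * y * b\<close>.\<close>

lemma addcl_indexed_sum:
  assumes "x \<in> addcl {g c b |c b. c \<in> C \<and> b \<in> B}" and "finite B"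
    and "0 \<in> C" and "\<And>c d. c \<in> C \<Longrightarrow> d \<in> C \<Longrightarrow> c + d \<in> C"
    and g0: "\<And>b. b \<in> B \<Longrightarrow> g 0 b = 0"
    and ga: "\<And>c d b. b \<in> B \<Longrightarrow> c \<in> C \<Longrightarrow> d \<in> C \<Longrightarrow> g (c + d) b = g c b + g d b"
  shows "\<exists>c. (\<forall>b\<in>B. c b \<in> C) \<and> x = (\<Sum>b\<in>B. g (c b) b)"
  using assms(1)
proof induction
  case addcl_zero
  show ?case by (rule exI[of _ "\<lambda>_. 0"]) (simp add: assms(3) g0)
next
  case (addcl_base x)
  then obtain c b where cb: "c \<in> C" "b \<in> B" "x = g c b" by auto
  have "(\<Sum>b'\<in>B. g (if b' = b then c else 0) b') = (\<Sum>b'\<in>B. if b' = b then g c b else 0)"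
    by (rule sum.cong) (auto simp: g0)
  also have "\<dots> = x" using cb \<open>finite B\<close> by simp
  finally show ?case
    using cb assms(3) by (intro exI[of _ "\<lambda>b'. if b' = b then c else 0"]) auto
next
  case (addcl_add x y)
  then obtain c d where "\<forall>b\<in>B. c b \<in> C" "x = (\<Sum>b\<in>B. g (c b) b)"
    "\<forall>b\<in>B. d b \<in> C" "y = (\<Sum>b\<in>B. g (d b) b)" by auto
  then show ?case
    using assms(4) by (intro exI[of _ "\<lambda>b. c b + d b"]) (simp add: ga sum.distrib)
qed

section \<open>Multilinear identities\<close>

lemma sum_permutations_of_set:
  assumes "finite I" and "I \<noteq> {}"
  shows "(\<Sum>u\<in>permutations_of_set I. h u) =
    (\<Sum>i\<in>I. \<Sum>u\<in>permutations_of_set (I - {i}). h (i # u))"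
proof -
  have "(\<Sum>u\<in>permutations_of_set I. h u) =
      (\<Sum>i\<in>I. \<Sum>u\<in>(#) i ` permutations_of_set (I - {i}). h u)"
    unfolding permutations_of_set_nonempty[OF assms(2)]
    by (subst sum.UNION_disjoint) (use assms in auto)
  also have "\<dots> = (\<Sum>i\<in>I. \<Sum>u\<in>permutations_of_set (I - {i}). h (i # u))"
    by (rule sum.cong[OF refl], subst sum.reindex) auto
  finally show ?thesis .
qed

section \<open>Compositions of additive maps along a word\<close>

lemma foldl_additive:
  fixes r :: "'i \<Rightarrow> 'a::monoid_add \<Rightarrow> 'a"
  assumes "\<And>i x y. i \<in> set u \<Longrightarrow> r i (x + y) = r i x + r i y"
  shows "foldl (\<lambda>x i. r i x) (x + y) u = foldl (\<lambda>x i. r i x) x u + foldl (\<lambda>x i. r i x) y u"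
  using assms by (induction u arbitrary: x y) auto

lemma foldl_zero:
  fixes r :: "'i \<Rightarrow> 'a::monoid_add \<Rightarrow> 'a"
  assumes "\<And>i. i \<in> set u \<Longrightarrow> r i 0 = 0"
  shows "foldl (\<lambda>x i. r i x) 0 u = 0"
  using assms by (induction u) auto

lemma foldl_fun_upd_notin:
  "j \<notin> set u \<Longrightarrow> foldl (\<lambda>x i. (r(j := g)) i x) w u = foldl (\<lambda>x i. r i x) w u"
  by (induction u arbitrary: w) auto

lemma foldl_update_zero:
  fixes r :: "'i \<Rightarrow> 'a::monoid_add \<Rightarrow> 'a"
  assumes "j \<in> set u" and "distinct u" and "\<And>i. i \<in> set u \<Longrightarrow> r i 0 = 0"
  shows "foldl (\<lambda>x i. (r(j := 0)) i x) w u = 0"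
proof -
  obtain s t where u: "u = s @ j # t" using assms(1) by (meson split_list)
  then show ?thesis
    using assms foldl_zero[of t r] by (simp add: foldl_fun_upd_notin del: fun_upd_apply)
       (simp add: fun_upd_apply)
qed

text \<open>The list is split at the only occurrence of \<open>j\<close>: the maps before it are
  unaffected, and the additive maps after it carry the sum through.\<close>

lemma foldl_update_add:
  fixes r :: "'i \<Rightarrow> 'a::monoid_add \<Rightarrow> 'a"
  assumes "j \<in> set u" and "distinct u"
    and "\<And>i x y. i \<in> set u \<Longrightarrow> i \<noteq> j \<Longrightarrow> r i (x + y) = r i x + r i y"
  shows "foldl (\<lambda>x i. (r(j := g + h)) i x) w u =
    foldl (\<lambda>x i. (r(j := g)) i x) w u + foldl (\<lambda>x i. (r(j := h)) i x) w u"
proof -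
  obtain s t where u: "u = s @ j # t" using assms(1) by (meson split_list)
  then have nt: "j \<notin> set s" "j \<notin> set t" using assms(2) by auto
  have add: "foldl (\<lambda>x i. r i x) (x + y) t = foldl (\<lambda>x i. r i x) x t + foldl (\<lambda>x i. r i x) y t" for x y
    by (rule foldl_additive) (use assms(3) u nt in auto)
  show ?thesis
    unfolding u foldl_append foldl.simps foldl_fun_upd_notin[OF nt(1)] foldl_fun_upd_notin[OF nt(2)]
    by (simp add: add)
qed

text \<open>Stated for additive maps rather than for ring elements, because it is applied to the maps
  \<open>x \<mapsto> l * x * a\<close>.\<close>

lemma multilinear_vanishes_addcl:
  fixes q :: "'i list \<Rightarrow> 'a::ring_1" and r :: "'i \<Rightarrow> 'a \<Rightarrow> 'a"
  assumes "finite I"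
    and additive: "\<And>g x y. g \<in> G \<Longrightarrow> g (x + y) = g x + g y"
    and vanish: "\<And>r. (\<And>i. r i \<in> G) \<Longrightarrow>
      (\<Sum>u\<in>permutations_of_set I. q u * foldl (\<lambda>x i. r i x) w u) = 0"
    and r: "\<And>i. i \<in> I \<Longrightarrow> r i \<in> addcl G" and "G \<noteq> {}"
  shows "(\<Sum>u\<in>permutations_of_set I. q u * foldl (\<lambda>x i. r i x) w u) = 0"
proof -
  have G0: "g 0 = 0" if "g \<in> G" for g
    using additive[OF that, of 0 0] by simp
  have addcl0: "g 0 = 0 \<and> (\<forall>x y. g (x + y) = g x + g y)" if "g \<in> addcl G" for g
    using that by induction (auto simp: additive G0 add_ac)
  \<comment> \<open>\<open>J\<close> collects the indices at which \<open>r\<close> may lie in the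
    closure; the induction relaxes \<open>G\<close> to \<open>addcl G\<close> at one index at a
    time.\<close>
  have main: "(\<Sum>u\<in>permutations_of_set I. q u * foldl (\<lambda>x i. r i x) w u) = 0"
    if "finite J" "J \<subseteq> I" "\<forall>i\<in>J. r i \<in> addcl G" "\<forall>i. i \<notin> J \<longrightarrow> r i \<in> G" for J r
    using that
  proof (induction J arbitrary: r rule: finite_induct)
    case empty
    then show ?case by (intro vanish) auto
  next
    case (insert j J)
    have jI: "j \<in> I" and perm: "\<And>u. u \<in> permutations_of_set I \<Longrightarrow> j \<in> set u \<and> distinct u"
      using insert.prems by (auto simp: permutations_of_set_def)
    have allr: "r i \<in> addcl G" for i
      using insert.prems by (cases "i \<in> insert j J") (auto intro: addcl_base)
    have "(\<Sum>u\<in>permutations_of_set I. q u * foldl (\<lambda>x i. (r(j := g)) i x) w u) = 0"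
      if "g \<in> addcl G" for g
      using that
    proof induction
      case addcl_zero
      have "foldl (\<lambda>x i. (r(j := 0)) i x) w u = 0" if "u \<in> permutations_of_set I" for u
        using perm[OF that] by (intro foldl_update_zero) (use allr addcl0 in auto)
      then show ?case by (intro sum.neutral ballI) (simp only: mult_zero_right)
    next
      case (addcl_base g)
      show ?case by (rule insert.IH) (use insert addcl_base in auto)
    next
      case (addcl_add g h)
      have "foldl (\<lambda>x i. (r(j := g + h)) i x) w u =
        foldl (\<lambda>x i. (r(j := g)) i x) w u + foldl (\<lambda>x i. (r(j := h)) i x) w u"
        if "u \<in> permutations_of_set I" for u
        using perm[OF that] by (intro foldl_update_add) (use allr addcl0 in auto)
      then have "(\<Sum>u\<in>permutations_of_set I. q u * foldl (\<lambda>x i. (r(j := g + h)) i x) w u) =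
        (\<Sum>u\<in>permutations_of_set I. q u * foldl (\<lambda>x i. (r(j := g)) i x) w u +
          q u * foldl (\<lambda>x i. (r(j := h)) i x) w u)"
        by (intro sum.cong refl) (simp only: distrib_left)
      then show ?case by (simp only: sum.distrib addcl_add.IH add_0)
    qed
    from this[OF allr[of j]] show ?case by simp
  qed
  \<comment> \<open>Outside \<open>I\<close> nothing is known about \<open>r\<close>. A member of
    \<open>G\<close> serves as default value there, and no permutation of \<open>I\<close> ever
    meets it.\<close>
  obtain g where g: "g \<in> G" using \<open>G \<noteq> {}\<close> by auto
  have "(\<Sum>u\<in>permutations_of_set I. q u * foldl (\<lambda>x i. (if i \<in> I then r i else g) x) w u) = 0"
    by (rule main[of I]) (use \<open>finite I\<close> r g in auto)
  moreover have "foldl (\<lambda>x i. (if i \<in> I then r i else g) x) w u = foldl (\<lambda>x i. r i x) w u"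
    if "u \<in> permutations_of_set I" for u
    using permutations_of_setD(1)[OF that] by (intro foldl_cong) auto
  ultimately show ?thesis by simp
qed

section \<open>Multilinearisation of a polynomial identity\<close>

lemma foldl_mult_prod_list:
  fixes y :: "'i \<Rightarrow> 'a::monoid_mult"
  shows "foldl (\<lambda>x i. x * y i) w u = w * prod_list (map y u)"
  by (induction u arbitrary: w) (auto simp: mult.assoc)

text \<open>Distributivity: choosing one summand in each factor of the monomial \<open>w\<close>
  amounts to choosing a word \<open>u\<close> that \<open>\<omega>\<close> maps letterwise to
  \<open>w\<close>.\<close>

lemma prod_list_map_sum_preimage:
  fixes y :: "'j \<Rightarrow> 'a::ring_1"
  assumes "finite T"
  shows "prod_list (map (\<lambda>i. \<Sum>j | j \<in> T \<and> \<omega> j = i. y j) w) =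
    (\<Sum>u | set u \<subseteq> T \<and> map \<omega> u = w. prod_list (map y u))"
proof (induction w)
  case Nil
  have "{u. set u \<subseteq> T \<and> map \<omega> u = []} = {[]}" by auto
  then show ?case by simp
next
  case (Cons i w)
  let ?J = "{j. j \<in> T \<and> \<omega> j = i}" and ?U = "{u. set u \<subseteq> T \<and> map \<omega> u = w}"
  have eq: "{u. set u \<subseteq> T \<and> map \<omega> u = i # w} = (\<lambda>(j, u). j # u) ` (?J \<times> ?U)"
    by (auto simp: image_iff map_eq_Cons_conv)
  have "(\<Sum>u | set u \<subseteq> T \<and> map \<omega> u = i # w. prod_list (map y u)) =
      (\<Sum>(j, u)\<in>?J \<times> ?U. y j * prod_list (map y u))"
    unfolding eq by (subst sum.reindex) (auto simp: inj_on_def case_prod_beta)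
  also have "\<dots> = (\<Sum>j\<in>?J. y j) * (\<Sum>u\<in>?U. prod_list (map y u))"
    by (simp add: sum_product sum.cartesian_product)
  finally show ?case using Cons by simp
qed

lemma finite_lists_map_in:
  assumes "finite T" and "finite W"
  shows "finite {u. set u \<subseteq> T \<and> map \<omega> u \<in> W}"
proof -
  have "{u. set u \<subseteq> T \<and> map \<omega> u \<in> W} \<subseteq> (\<Union>w\<in>W. {u. set u \<subseteq> T \<and> length u = length w})"
    by (auto dest: map_eq_imp_length_eq)
  then show ?thesis
    by (rule finite_subset) (use assms finite_lists_length_eq in auto)
qed

text \<open>Each word \<open>u\<close> over \<open>T\<close> arises from exactly one monomial,
  namely \<open>map \<omega> u\<close>. Restricting to nonzero coefficients bounds the length of
  \<open>u\<close> and so keeps the sum finite.\<close>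

lemma ncpoly_eval_sum_preimage:
  fixes p :: "nat list \<Rightarrow> 'a::ring_1" and y :: "nat \<Rightarrow> 'a"
  assumes "finite T" and fin: "finite {w. p w \<noteq> 0}"
  shows "ncpoly_eval p (\<lambda>i. \<Sum>j | j \<in> T \<and> \<omega> j = i. y j) =
    (\<Sum>u | set u \<subseteq> T \<and> p (map \<omega> u) \<noteq> 0. p (map \<omega> u) * prod_list (map y u))"
proof -
  let ?U = "{u. set u \<subseteq> T \<and> map \<omega> u \<in> {w. p w \<noteq> 0}}"
  have "ncpoly_eval p (\<lambda>i. \<Sum>j | j \<in> T \<and> \<omega> j = i. y j) =
      (\<Sum>w | p w \<noteq> 0. \<Sum>u | set u \<subseteq> T \<and> map \<omega> u = w. p (map \<omega> u) * prod_list (map y u))"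
    unfolding ncpoly_eval_def prod_list_map_sum_preimage[OF \<open>finite T\<close>]
    by (auto simp: sum_distrib_left intro!: sum.cong)
  also have "\<dots> = (\<Sum>w | p w \<noteq> 0. \<Sum>u | u \<in> ?U \<and> map \<omega> u = w. p (map \<omega> u) * prod_list (map y u))"
    by (intro sum.cong) auto
  also have "\<dots> = (\<Sum>u\<in>?U. p (map \<omega> u) * prod_list (map y u))"
    by (rule sum.group) (use finite_lists_map_in[OF assms] fin in auto)
  finally show ?thesis by simp
qed

text \<open>Multilinearisation. Let \<open>v\<close> be a longest word of the identity, of length \<open>d\<close>. Substituting
  for the variable \<open>i\<close> the sum of those \<open>y j\<close>, \<open>j \<in> T\<close>, with \<open>v ! j = i\<close> and applying
  inclusion-exclusion over \<open>T\<close> isolates the words in which every \<open>y j\<close> with \<open>j < d\<close> occurs;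
  having length at most \<open>d\<close>, these are permutations.\<close>

lemma satisfies_PI_multilinear:
  fixes A :: "'a::ring_1 set"
  assumes "satisfies_PI F A" and "0 \<in> A" and "\<forall>x\<in>A. \<forall>y\<in>A. x + y \<in> A"
  shows "\<exists>(d::nat) q u0. (\<forall>u. q u \<in> F) \<and> u0 \<in> permutations_of_set {..<d} \<and> q u0 \<noteq> 0 \<and>
    (\<forall>y. (\<forall>i. y i \<in> A) \<longrightarrow>
      (\<Sum>u\<in>permutations_of_set {..<d}. q u * prod_list (map y u)) = 0)"
proof -
  obtain p where fin: "finite {w. p w \<noteq> 0}" and pF: "\<And>w. p w \<in> F"
    and nz: "{w. p w \<noteq> 0} \<noteq> {}" and p0: "\<And>a. (\<And>i. a i \<in> A) \<Longrightarrow> ncpoly_eval p a = 0"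
    using assms(1) by (auto simp: satisfies_PI_def is_ncpoly_def)
  define d where "d = Max (length ` {w. p w \<noteq> 0})"
  have "d \<in> length ` {w. p w \<noteq> 0}"
    unfolding d_def by (rule Max_in) (use fin nz in auto)
  then obtain v where v: "p v \<noteq> 0" "length v = d" by auto
  have len: "length w \<le> d" if "p w \<noteq> 0" for w
    unfolding d_def by (rule Max_ge) (use fin that in auto)
  \<comment> \<open>The positions of \<open>v\<close> become the new variables, so repeated letters
    of \<open>v\<close> are told apart; \<open>[0..<d]\<close> carries the coefficient of
    \<open>v\<close> itself.\<close>
  define q where "q u = p (map ((!) v) u)" for u
  show ?thesis
  proof (intro exI conjI)
    show "\<forall>u. q u \<in> F" by (simp add: q_def pF)
    show "[0..<d] \<in> permutations_of_set {..<d}" by (auto simp: permutations_of_set_def)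
    have "map ((!) v) [0..<d] = v" using v(2) map_nth by blast
    then show "q [0..<d] \<noteq> 0" using v(1) by (simp add: q_def)
    show "\<forall>y. (\<forall>i. y i \<in> A) \<longrightarrow>
      (\<Sum>u\<in>permutations_of_set {..<d}. q u * prod_list (map y u)) = 0"
    proof (intro allI impI)
      fix y :: "nat \<Rightarrow> 'a" assume y: "\<forall>i. y i \<in> A"
      let ?t = "\<lambda>u. q u * prod_list (map y u)"
      let ?f = "\<lambda>R. \<Sum>u | set u = R \<and> q u \<noteq> 0. ?t u"
      have inA: "sum y J \<in> A" for J
        using assms(2,3) y by (induction J rule: infinite_finite_induct) auto
      \<comment> \<open>Grouping words by their set of letters turns the sum over subsets of
        \<open>T\<close> into the identity evaluated at a partial substitution. All cumulative sums
        thus vanish, and Moebius inversion makes \<open>?f\<close> vanish.\<close>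
      have g0: "0 = sum ?f (Pow T)" if "finite T" for T
      proof -
        let ?U = "{u. set u \<subseteq> T \<and> q u \<noteq> 0}"
        have "sum ?f (Pow T) = (\<Sum>R\<in>Pow T. \<Sum>u | u \<in> ?U \<and> set u = R. ?t u)"
          by (intro sum.cong) auto
        also have "\<dots> = (\<Sum>u\<in>?U. ?t u)"
          by (rule sum.group) (use finite_lists_map_in[OF that fin, of "(!) v"] that in \<open>auto simp: q_def\<close>)
        also have "\<dots> = ncpoly_eval p (\<lambda>i. \<Sum>j | j \<in> T \<and> v ! j = i. y j)"
          using ncpoly_eval_sum_preimage[OF that fin, where \<omega> = "(!) v" and y = y]
          by (simp add: q_def)
        also have "\<dots> = 0" by (intro p0 inA)
        finally show ?thesis by simp
      qed
      have "?f {..<d} = (\<Sum>T\<in>Pow {..<d}. (-1) ^ (card {..<d} - card T) * 0)"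
        by (rule inclusion_exclusion_mobius) (use g0 in auto)
      also have "\<dots> = 0" by simp
      finally have "?f {..<d} = 0" .
      also have "?f {..<d} = (\<Sum>u\<in>permutations_of_set {..<d}. ?t u)"
      proof (rule sum.mono_neutral_left)
        show "{u. set u = {..<d} \<and> q u \<noteq> 0} \<subseteq> permutations_of_set {..<d}"
        proof
          fix u assume "u \<in> {u. set u = {..<d} \<and> q u \<noteq> 0}"
          \<comment> \<open>A word of length at most \<open>d\<close> with \<open>d\<close>
            different letters has no repetitions.\<close>
          then have u: "set u = {..<d}" "length u \<le> d" using len[of "map ((!) v) u"] by (auto simp: q_def)
          then have "card (set u) = length u" using card_length[of u] by simp
          then show "u \<in> permutations_of_set {..<d}" using u card_distinct by blast
        qed
      next
        show "\<forall>u\<in>permutations_of_set {..<d} - {u. set u = {..<d} \<and> q u \<noteq> 0}. ?t u = 0"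
          by (auto dest: permutations_of_setD)
      qed simp
      finally show "(\<Sum>u\<in>permutations_of_set {..<d}. ?t u) = 0" .
    qed
  qed
qed

section \<open>The standard identity\<close>

lemma prod_list_map_commuting:
  fixes c :: "'i \<Rightarrow> 'a::monoid_mult"
  assumes "mset u = mset v" and "\<And>i j. i \<in> set u \<Longrightarrow> j \<in> set u \<Longrightarrow> c i * c j = c j * c i"
  shows "prod_list (map c u) = prod_list (map c v)"
proof -
  \<comment> \<open>Left multiplications build the product from its last factor, hence the
    reversal.\<close>
  have eq: "prod_list (map c w) = fold (\<lambda>i x. c i * x) (rev w) 1" for w
    by (induction w) simp_all
  have "fold (\<lambda>i x. c i * x) (rev u) = fold (\<lambda>i x. c i * x) (rev v)"
    using assms by (intro fold_multiset_equiv) (auto simp: fun_eq_iff simp flip: mult.assoc)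
  then show ?thesis by (simp add: eq)
qed

lemma prod_list_map_mult_commuting:
  fixes c b :: "'i \<Rightarrow> 'a::monoid_mult"
  assumes "\<And>i j. i \<in> set u \<Longrightarrow> j \<in> set u \<Longrightarrow> c i * b j = b j * c i"
  shows "prod_list (map (\<lambda>i. c i * b i) u) = prod_list (map c u) * prod_list (map b u)"
  using assms
proof (induction u)
  case (Cons j u)
  have comm: "b j * prod_list (map c v) = prod_list (map c v) * b j" if "set v \<subseteq> set u" for v
    using that
  proof (induction v)
    case (Cons k v)
    then have "b j * c k = c k * b j"
      using \<open>\<And>i j'. i \<in> set (j # u) \<Longrightarrow> j' \<in> set (j # u) \<Longrightarrow> c i * b j' = b j' * c i\<close>[of k j]
      by simp
    moreover have "b j * prod_list (map c v) = prod_list (map c v) * b j" using Cons by simp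
    ultimately show ?case by (metis list.map(2) mult.assoc prod_list.Cons)
  qed simp
  have "prod_list (map (\<lambda>i. c i * b i) u) = prod_list (map c u) * prod_list (map b u)"
    by (rule Cons.IH) (use Cons.prems in auto)
  then have "prod_list (map (\<lambda>i. c i * b i) (j # u)) = c j * (b j * prod_list (map c u)) * prod_list (map b u)"
    by (simp add: mult.assoc)
  then show ?case using comm[of u] by (simp add: mult.assoc)
qed simp

text \<open>The coefficients of the standard polynomial of degree \<open>d\<close>: \<open>u\<close>
  is read as the permutation sending the position \<open>k\<close> to \<open>u ! k\<close>.\<close>

abbreviation std_coeff :: "nat \<Rightarrow> nat list \<Rightarrow> 'a::ring_1" where
  "std_coeff d u \<equiv> of_int (sign_on {..<d} ((!) u))"

lemma std_coeff_cases: "std_coeff d u = (1::'a::ring_1) \<or> std_coeff d u = (-1::'a)"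
  by (simp add: sign_on_def sign_def)

text \<open>Transposing the letters \<open>i\<close> and \<open>j\<close> reverses the sign and
  preserves the product, so even and odd words cancel in pairs. Unlike an argument through
  \<open>x = - x\<close>, the pairing is valid in characteristic two.\<close>

lemma standard_identity_repeated:
  fixes y :: "nat \<Rightarrow> 'a::ring_1"
  assumes "i < d" and "j < d" and "i \<noteq> j" and "y i = y j"
  shows "(\<Sum>u\<in>permutations_of_set {..<d}. std_coeff d u * prod_list (map y u)) = 0"
proof -
  let ?P = "permutations_of_set {..<d}" and ?\<tau> = "Transposition.transpose i j"
  \<comment> \<open>The sign stays an integer: \<open>1\<close> and \<open>-1\<close> differ as
    integers even if they coincide in the ring.\<close>
  define s where "s u = sign_on {..<d} ((!) u)" for u
  have s_cases: "s u = 1 \<or> s u = -1" for u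
    by (simp add: s_def sign_on_def sign_def)
  have P: "map ?\<tau> u \<in> ?P" if "u \<in> ?P" for u
  proof -
    have "?\<tau> permutes {..<d}" using assms by (intro permutes_swap_id) auto
    then have "?\<tau> ` {..<d} = {..<d}" by (rule permutes_image)
    then show ?thesis using that by (auto simp: permutations_of_set_def distinct_map)
  qed
  have s: "s (map ?\<tau> u) = - s u" if "u \<in> ?P" for u
  proof -
    have u: "set u = {..<d}" "distinct u" using that by (auto dest: permutations_of_setD)
    then have len: "length u = d" using distinct_card by fastforce
    have bij: "bij_betw ((!) u) {..<d} {..<d}" using u len by (intro bij_betw_nth) auto
    have bijt: "bij_betw ?\<tau> {..<d} {..<d}"
      using assms by (intro permutes_imp_bij permutes_swap_id) auto
    have "s (map ?\<tau> u) = sign_on {..<d} (?\<tau> \<circ> (!) u)"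
      unfolding s_def by (rule sign_on_cong) (auto simp: len)
    also have "\<dots> = sign_on {..<d} ?\<tau> * s u"
      unfolding s_def by (rule sign_on_compose[OF bijt bij]) simp
    also have "sign_on {..<d} ?\<tau> = -1" using assms by (intro sign_on_transpose) auto
    finally show ?thesis by simp
  qed
  have y: "prod_list (map y (map ?\<tau> u)) = prod_list (map y u)" for u
  proof -
    have "y (?\<tau> k) = y k" for k using assms(4) by (auto simp: Transposition.transpose_def)
    then show ?thesis by (simp add: comp_def)
  qed
  have invol: "map ?\<tau> (map ?\<tau> u) = u" for u by (simp add: comp_def)
  have "(\<Sum>u\<in>?P. of_int (s u) * prod_list (map y u)) =
      (\<Sum>u | u \<in> ?P \<and> s u = 1. of_int (s u) * prod_list (map y u)) +
      (\<Sum>u | u \<in> ?P \<and> s u = -1. of_int (s u) * prod_list (map y u))"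
    by (subst sum.union_disjoint[symmetric]) (use s_cases in \<open>auto intro!: sum.cong\<close>)
  also have "(\<Sum>u | u \<in> ?P \<and> s u = -1. of_int (s u) * prod_list (map y u)) =
      (\<Sum>u | u \<in> ?P \<and> s u = 1. - prod_list (map y u))"
    by (rule sum.reindex_bij_witness[of _ "map ?\<tau>" "map ?\<tau>"]) (auto simp: invol P s y simp del: map_map)
  finally show ?thesis by (simp add: s_def sum_negf)
qed

lemma of_int_left_commute: "of_int k * (x * y) = x * (of_int k * y :: 'a::ring_1)"
proof -
  have "of_int k * (x * y) = (of_int k * x) * y" by (simp only: mult.assoc)
  also have "\<dots> = x * of_int k * y" by (simp only: mult_of_int_commute)
  finally show ?thesis by (simp only: mult.assoc)
qed

text \<open>Multilinearity reduces to arguments \<open>c * b\<close>. The factors \<open>c\<close>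
  commute with each other and with \<open>B\<close>, so they move out in a fixed order; among more
  than \<open>card B\<close> remaining factors \<open>b\<close>, two are equal.\<close>

lemma standard_identity:
  fixes y :: "nat \<Rightarrow> 'a::ring_1"
  assumes "finite B" and "card B < d" and "C \<noteq> {}" and "B \<noteq> {}"
    and CC: "\<And>c c'. c \<in> C \<Longrightarrow> c' \<in> C \<Longrightarrow> c * c' = c' * c"
    and CB: "\<And>c b. c \<in> C \<Longrightarrow> b \<in> B \<Longrightarrow> c * b = b * c"
    and y: "\<And>i. y i \<in> addcl {c * b |c b. c \<in> C \<and> b \<in> B}"
  shows "(\<Sum>u\<in>permutations_of_set {..<d}. std_coeff d u * prod_list (map y u)) = 0"
proof -
  let ?G = "{\<lambda>x. x * (c * b) |c b. c \<in> C \<and> b \<in> B}"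
  have "(\<Sum>u\<in>permutations_of_set {..<d}. std_coeff d u * foldl (\<lambda>x i. (\<lambda>x. x * y i) x) 1 u) = 0"
  proof (rule multilinear_vanishes_addcl[where G = ?G])
    show "(\<lambda>x. x * y i) \<in> addcl ?G" for i
    proof (rule addcl_additive_image[OF y, where h = "\<lambda>z x. x * z"])
      fix z assume "z \<in> {c * b |c b. c \<in> C \<and> b \<in> B}"
      then show "(\<lambda>x. x * z) \<in> addcl ?G" by (auto intro!: addcl_base)
    qed (auto simp: fun_eq_iff distrib_left)
  next
    fix r :: "nat \<Rightarrow> 'a \<Rightarrow> 'a" assume "\<And>i. r i \<in> ?G"
    then have "\<forall>i. \<exists>c b. c \<in> C \<and> b \<in> B \<and> r i = (\<lambda>x. x * (c * b))" by blast
    then obtain c b where r: "\<And>i. c i \<in> C" "\<And>i. b i \<in> B" "\<And>i. r i = (\<lambda>x. x * (c i * b i))"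
      by metis
    have "\<not> inj_on b {..<d}"
      using card_inj_on_le[of b "{..<d}" B] r(2) \<open>finite B\<close> \<open>card B < d\<close> by auto
    then obtain i j where ij: "i < d" "j < d" "i \<noteq> j" "b i = b j" by (auto simp: inj_on_def)
    let ?c = "prod_list (map c [0..<d])"
    have "foldl (\<lambda>x i. r i x) 1 u = ?c * prod_list (map b u)" if "u \<in> permutations_of_set {..<d}" for u
    proof -
      have "mset u = mset [0..<d]"
        using that by (intro set_eq_iff_mset_eq_distinct[THEN iffD1])
          (auto dest: permutations_of_setD)
      then have "prod_list (map c u) = ?c"
        by (rule prod_list_map_commuting) (simp add: CC r)
      moreover have "prod_list (map (\<lambda>i. c i * b i) u) = prod_list (map c u) * prod_list (map b u)"
        by (rule prod_list_map_mult_commuting) (simp add: CB r)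
      ultimately show ?thesis by (simp add: r(3) foldl_mult_prod_list)
    qed
    then have "(\<Sum>u\<in>permutations_of_set {..<d}. std_coeff d u * foldl (\<lambda>x i. r i x) 1 u) =
       (\<Sum>u\<in>permutations_of_set {..<d}. ?c * (std_coeff d u * prod_list (map b u)))"
      by (intro sum.cong refl) (simp add: of_int_left_commute)
    also have "\<dots> = 0"
      using standard_identity_repeated[of i d j b, OF ij] by (simp flip: sum_distrib_left)
    finally show "(\<Sum>u\<in>permutations_of_set {..<d}. std_coeff d u * foldl (\<lambda>x i. r i x) 1 u) = 0" .
  qed (use assms in \<open>auto simp: distrib_right\<close>)
  then show ?thesis by (simp add: foldl_mult_prod_list)
qed

section \<open>Spans over a division subring\<close>

lemma division_subringD:
  assumes "division_subring K"
  shows "0 \<in> K" and "1 \<in> K" and "x \<in> K \<Longrightarrow> y \<in> K \<Longrightarrow> x + y \<in> K"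
    and "x \<in> K \<Longrightarrow> y \<in> K \<Longrightarrow> x * y \<in> K" and "x \<in> K \<Longrightarrow> - x \<in> K"
    and "x \<in> K \<Longrightarrow> y \<in> K \<Longrightarrow> x - y \<in> K" and "x \<in> K \<Longrightarrow> inverse x \<in> K"
  using assms unfolding division_subring_def
  by (auto simp: diff_conv_add_uminus simp del: add_uminus_conv_diff)

definition lspan :: "'a::ring_1 set \<Rightarrow> 'a set \<Rightarrow> 'a set" where
  "lspan L V = addcl {l * v |l v. l \<in> L \<and> v \<in> V}"

lemma lspan_mono: "V \<subseteq> W \<Longrightarrow> lspan L V \<subseteq> lspan L W"
  unfolding lspan_def by (rule addcl_mono) auto

lemma lspan_add: "x \<in> lspan L V \<Longrightarrow> y \<in> lspan L V \<Longrightarrow> x + y \<in> lspan L V"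
  unfolding lspan_def by (rule addcl_add)

lemma lspan_sum: "(\<And>i. i \<in> I \<Longrightarrow> f i \<in> lspan L V) \<Longrightarrow> sum f I \<in> lspan L V"
  unfolding lspan_def by (rule addcl_sum)

lemma lspan_zero: "0 \<in> lspan L V"
  unfolding lspan_def by (rule addcl_zero)

lemma lspan_image_subset:
  assumes "x \<in> lspan L V" and "h 0 = 0" and "\<And>x y. h (x + y) = h x + h y"
    and "\<And>l v. l \<in> L \<Longrightarrow> v \<in> V \<Longrightarrow> h (l * v) \<in> lspan L W"
  shows "h x \<in> lspan L W"
  using assms(1) unfolding lspan_def
  by (rule addcl_additive_image) (use assms(2-) in \<open>auto simp: lspan_def\<close>)

locale left_spans =
  fixes L :: "'a::division_ring set"
  assumes L: "division_subring L"
begin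

lemma lspan_base: "l \<in> L \<Longrightarrow> v \<in> V \<Longrightarrow> l * v \<in> lspan L V"
  unfolding lspan_def by (rule addcl_base) blast

lemma lspan_superset: "V \<subseteq> lspan L V"
  using lspan_base[OF division_subringD(2)[OF L], of _ V] by auto

lemma lspan_scale:
  assumes "x \<in> lspan L V" and "l \<in> L"
  shows "l * x \<in> lspan L V"
  using assms(1)
proof (rule lspan_image_subset[where h = "(*) l"])
  fix m v assume "m \<in> L" "v \<in> V"
  then have "l * m * v \<in> lspan L V" using division_subringD(4)[OF L assms(2)] by (intro lspan_base)
  then show "l * (m * v) \<in> lspan L V" by (simp only: mult.assoc)
qed (simp_all add: distrib_left)

lemma lspan_minus: "x \<in> lspan L V \<Longrightarrow> - x \<in> lspan L V"
  using lspan_scale[of x V "- 1"] division_subringD[OF L] by simp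

lemma lspan_diff: "x \<in> lspan L V \<Longrightarrow> y \<in> lspan L V \<Longrightarrow> x - y \<in> lspan L V"
  using lspan_add[of x L V "- y"] lspan_minus[of y V] by simp

lemma lspan_subsetI:
  assumes "V \<subseteq> lspan L W"
  shows "lspan L V \<subseteq> lspan L W"
proof
  fix x assume "x \<in> lspan L V"
  then show "x \<in> lspan L W"
    by (rule lspan_image_subset[where h = "\<lambda>x. x"]) (use assms lspan_scale in blast)+
qed

lemma lspan_insertE:
  assumes "x \<in> lspan L (insert v V)"
  obtains l where "l \<in> L" and "x - l * v \<in> lspan L V"
proof -
  have "\<exists>l\<in>L. x - l * v \<in> lspan L V"
    using assms unfolding lspan_def[of L "insert v V"]
  proof induction
    case addcl_zero
    show ?case by (rule bexI[OF _ division_subringD(1)[OF L]]) (simp add: lspan_zero)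
  next
    case (addcl_base x)
    then obtain l w where lw: "x = l * w" "l \<in> L" "w = v \<or> w \<in> V" by auto
    show ?case
    proof (cases "w = v")
      case True
      then show ?thesis using lw by (intro bexI[of _ l]) (simp_all add: lspan_zero)
    next
      case False
      then have "x \<in> lspan L V" using lw by (simp add: lspan_base)
      then show ?thesis by (intro bexI[OF _ division_subringD(1)[OF L]]) simp
    qed
  next
    case (addcl_add x y)
    then obtain l m where "l \<in> L" "m \<in> L" "x - l * v \<in> lspan L V" "y - m * v \<in> lspan L V" by auto
    then have "l + m \<in> L" "x + y - (l + m) * v \<in> lspan L V"
      using division_subringD(3)[OF L] lspan_add[of "x - l * v" L V "y - m * v"]
      by (auto simp: algebra_simps)
    then show ?case by blast
  qed
  then show thesis using that by blast
qed

section \<open>Steinitz exchange and independence\<close>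

lemma lspan_exchange:
  assumes "x \<in> lspan L (insert v V)" and "x \<notin> lspan L V"
  shows "v \<in> lspan L (insert x V)"
proof -
  obtain l where l: "l \<in> L" "x - l * v \<in> lspan L V" using assms(1) by (rule lspan_insertE)
  then have "l \<noteq> 0" using assms(2) by auto
  have lv: "x - (x - l * v) \<in> lspan L (insert x V)"
  proof (rule lspan_diff)
    show "x \<in> lspan L (insert x V)" using lspan_superset by blast
    show "x - l * v \<in> lspan L (insert x V)" using l(2) lspan_mono[of V "insert x V" L] by blast
  qed
  have "inverse l * (x - (x - l * v)) \<in> lspan L (insert x V)"
    by (rule lspan_scale[OF lv division_subringD(7)[OF L l(1)]])
  then show ?thesis using \<open>l \<noteq> 0\<close> by (simp flip: mult.assoc)
qed

text \<open>Linear independence in triangular form: each entry is compared only with the span of the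
  later ones, so a list is easily extended at its head.\<close>

fun independent :: "'a list \<Rightarrow> bool" where
  "independent [] \<longleftrightarrow> True"
| "independent (x # xs) \<longleftrightarrow> x \<notin> lspan L (set xs) \<and> independent xs"

text \<open>\<open>P\<close> holds the vectors to be kept. As \<open>x\<close> is outside the span
  of \<open>P\<close>, some vector of \<open>V\<close> contributes to \<open>x\<close> and can be
  exchanged for it.\<close>

lemma lspan_exchange_finite:
  assumes "finite V" and "x \<in> lspan L (P \<union> V)" and "x \<notin> lspan L P"
  shows "\<exists>v\<in>V. v \<in> lspan L (insert x (P \<union> (V - {v})))"
  using assms
proof (induction V rule: finite_induct)
  case (insert v V)
  show ?case
  proof (cases "x \<in> lspan L (P \<union> V)")
    case True
    then obtain w where w: "w \<in> V" "w \<in> lspan L (insert x (P \<union> (V - {w})))"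
      using insert.IH[OF True insert.prems(2)] by blast
    moreover have "lspan L (insert x (P \<union> (V - {w}))) \<subseteq> lspan L (insert x (P \<union> (insert v V - {w})))"
      by (rule lspan_mono) auto
    ultimately show ?thesis by blast
  next
    case False
    then have "v \<in> lspan L (insert x (P \<union> V))"
      using lspan_exchange[of x v "P \<union> V"] insert.prems(1) by simp
    moreover have "insert v V - {v} = V" using insert.hyps by auto
    ultimately show ?thesis by (intro bexI[of _ v]) simp_all
  qed
qed simp

lemma independent_length_le:
  assumes "independent xs" and "set xs \<subseteq> lspan L V" and "finite V"
  shows "length xs \<le> card V"
proof -
  \<comment> \<open>\<open>W\<close> consists of the vectors of \<open>V\<close> not yet exchanged
    for entries of \<open>xs\<close>.\<close>
  have "\<exists>W\<subseteq>V. card W + length xs = card V \<and> V \<subseteq> lspan L (set xs \<union> W)"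
    using assms(1,2)
  proof (induction xs)
    case Nil
    show ?case using lspan_superset by (intro exI[of _ V]) simp
  next
    case (Cons x xs)
    then obtain W where W: "W \<subseteq> V" "card W + length xs = card V" "V \<subseteq> lspan L (set xs \<union> W)"
      by (metis independent.simps(2) insert_subset list.simps(15))
    then have "x \<in> lspan L (set xs \<union> W)"
      using lspan_subsetI[OF W(3)] Cons.prems(2) by (meson list.set_intros(1) subsetD)
    moreover have "finite W" using W(1) assms(3) finite_subset by auto
    ultimately obtain v where v: "v \<in> W" "v \<in> lspan L (insert x (set xs \<union> (W - {v})))"
      using lspan_exchange_finite[of W x "set xs"] Cons.prems(1) by (meson independent.simps(2))
    let ?U = "insert x (set xs \<union> (W - {v}))"
    have "set xs \<union> W \<subseteq> lspan L ?U" using v(2) lspan_superset[of ?U] by blast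
    then have "V \<subseteq> lspan L ?U" using W(3) lspan_subsetI by blast
    moreover have "card (W - {v}) + length (x # xs) = card V"
      using v(1) \<open>finite W\<close> W(2) card_Suc_Diff1[of W v] by simp
    moreover have "set (x # xs) \<union> (W - {v}) = ?U" by auto
    ultimately show ?case using W(1) by (intro exI[of _ "W - {v}"]) (simp only:, blast)
  qed
  then show ?thesis by auto
qed

text \<open>Right multiplication by \<open>b\<close> is left \<open>L\<close>-linear and is undone
  by right multiplication by \<open>inverse b\<close>.\<close>

lemma independent_mult_right:
  assumes "b \<noteq> 0" and "independent xs"
  shows "independent (map (\<lambda>x. x * b) xs)"
  using assms(2)
proof (induction xs)
  case (Cons x xs)
  have "x \<in> lspan L (set xs)" if "x * b \<in> lspan L ((\<lambda>x. x * b) ` set xs)"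
  proof -
    have "(x * b) * inverse b \<in> lspan L (set xs)"
    proof (rule lspan_image_subset[OF that, where h = "\<lambda>z. z * inverse b"])
      fix l v assume "l \<in> L" "v \<in> (\<lambda>x. x * b) ` set xs"
      then obtain w where "w \<in> set xs" "v = w * b" by auto
      then show "l * v * inverse b \<in> lspan L (set xs)"
        using \<open>l \<in> L\<close> \<open>b \<noteq> 0\<close> lspan_scale[OF subsetD[OF lspan_superset], of w "set xs" l]
        by (simp add: mult.assoc)
    qed (auto simp: distrib_right)
    then show ?thesis using \<open>b \<noteq> 0\<close> by (simp add: mult.assoc)
  qed
  then show ?case using Cons by auto
qed simp

lemma infinite_dim_independent:
  assumes "\<And>V. finite V \<Longrightarrow> V \<subseteq> K \<Longrightarrow> \<not> K \<subseteq> lspan L V"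
  shows "\<exists>xs. length xs = n \<and> set xs \<subseteq> K \<and> independent xs"
proof (induction n)
  case (Suc n)
  then obtain xs where xs: "length xs = n" "set xs \<subseteq> K" "independent xs" by auto
  then obtain x where "x \<in> K" "x \<notin> lspan L (set xs)" using assms[of "set xs"] by auto
  then show ?case using xs by (intro exI[of _ "x # xs"]) auto
qed auto

end

text \<open>The image of the tensor product of \<open>L\<close> and \<open>A\<close> in the additive
  maps.\<close>

definition bimaps :: "'a::ring_1 set \<Rightarrow> 'a set \<Rightarrow> ('a \<Rightarrow> 'a) set" where
  "bimaps L A = addcl {\<lambda>x. l * x * a |l a. l \<in> L \<and> a \<in> A}"

lemma bimaps_base: "l \<in> L \<Longrightarrow> a \<in> A \<Longrightarrow> (\<lambda>x. l * x * a) \<in> bimaps L A"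
  unfolding bimaps_def by (intro addcl_base) auto

lemma bimaps_additive:
  assumes "r \<in> bimaps L A"
  shows "r (x + y) = r x + r y" and "r 0 = 0" and "r (x - y) = r x - r y"
proof -
  have *: "r (x + y) = r x + r y" for x y
    using assms unfolding bimaps_def by induction (auto simp: algebra_simps)
  show "r (x + y) = r x + r y" by (rule *)
  show "r 0 = 0" using *[of 0 0] by simp
  show "r (x - y) = r x - r y" using *[of "x - y" y] by simp
qed

lemma bimaps_plus: "r \<in> bimaps L A \<Longrightarrow> s \<in> bimaps L A \<Longrightarrow> (\<lambda>x. r x + s x) \<in> bimaps L A"
  using addcl_add[of r "{\<lambda>x. l * x * a |l a. l \<in> L \<and> a \<in> A}" s] unfolding bimaps_def plus_fun_def .

lemma bimaps_mult_right:
  assumes "r \<in> bimaps L A" and "\<And>a. a \<in> A \<Longrightarrow> a * b \<in> A'"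
  shows "(\<lambda>x. r x * b) \<in> bimaps L A'"
  using assms(1) unfolding bimaps_def
proof (rule addcl_additive_image[where h = "\<lambda>r x. r x * b"])
  fix r assume "r \<in> {\<lambda>x. l * x * a |l a. l \<in> L \<and> a \<in> A}"
  then obtain l a where "r = (\<lambda>x. l * x * a)" "l \<in> L" "a \<in> A" by auto
  then show "(\<lambda>x. r x * b) \<in> addcl {\<lambda>x. l * x * a |l a. l \<in> L \<and> a \<in> A'}"
    using assms(2) bimaps_base[of l L "a * b" A'] by (simp add: bimaps_def mult.assoc)
qed (auto simp: fun_eq_iff distrib_right)

lemma bimaps_mult_left:
  assumes "r \<in> bimaps L A" and "\<And>l. l \<in> L \<Longrightarrow> m * l \<in> L'"
  shows "(\<lambda>x. m * r x) \<in> bimaps L' A"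
  using assms(1) unfolding bimaps_def
proof (rule addcl_additive_image[where h = "\<lambda>r x. m * r x"])
  fix r assume "r \<in> {\<lambda>x. l * x * a |l a. l \<in> L \<and> a \<in> A}"
  then obtain l a where "r = (\<lambda>x. l * x * a)" "l \<in> L" "a \<in> A" by auto
  then show "(\<lambda>x. m * r x) \<in> addcl {\<lambda>x. l * x * a |l a. l \<in> L' \<and> a \<in> A}"
    using assms(2) bimaps_base[of "m * l" L' a A] by (simp add: bimaps_def mult.assoc)
qed (auto simp: fun_eq_iff distrib_left)

lemma bimaps_linear:
  assumes "r \<in> bimaps L A" and "\<And>l. l \<in> L \<Longrightarrow> m * l = l * m"
  shows "r (m * x) = m * r x"
  using assms(1) unfolding bimaps_def
proof induction
  case (addcl_base r)
  then obtain l a where "r = (\<lambda>x. l * x * a)" "l \<in> L" by auto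
  then show ?case using assms(2)[of l] by (metis mult.assoc)
qed (auto simp: distrib_left)

lemma bimaps_closed:
  assumes "division_subring K" and "L \<subseteq> K" and "A \<subseteq> K" and "r \<in> bimaps L A" and "x \<in> K"
  shows "r x \<in> K"
  using assms(4) unfolding bimaps_def
  by induction (use assms in \<open>auto intro!: division_subringD(1,3,4)\<close>)

text \<open>Finiteness of the set of right factors is what later permits a common denominator and a
  finite spanning set over the center.\<close>

lemma bimaps_finite_support:
  assumes "r \<in> bimaps L A"
  shows "\<exists>X. finite X \<and> X \<subseteq> A \<and> r \<in> bimaps L X"
  using assms unfolding bimaps_def[of L A]
proof induction
  case addcl_zero
  show ?case unfolding bimaps_def by (intro exI[of _ "{}"] conjI addcl.addcl_zero) auto
next
  case (addcl_base r)
  then obtain l a where "r = (\<lambda>x. l * x * a)" "l \<in> L" "a \<in> A" by auto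
  then show ?case by (intro exI[of _ "{a}"]) (auto intro: bimaps_base)
next
  case (addcl_add r s)
  then obtain X Y where XY: "finite X" "X \<subseteq> A" "r \<in> bimaps L X" "finite Y" "Y \<subseteq> A" "s \<in> bimaps L Y"
    by auto
  have "bimaps L X \<subseteq> bimaps L (X \<union> Y)" "bimaps L Y \<subseteq> bimaps L (X \<union> Y)"
    unfolding bimaps_def by (intro addcl_mono; blast)+
  then have "r + s \<in> bimaps L (X \<union> Y)"
    using XY unfolding bimaps_def by (auto intro: addcl.addcl_add)
  moreover have "finite (X \<union> Y)" "X \<union> Y \<subseteq> A" using XY by auto
  ultimately show ?case by blast
qed

lemma bimaps_zero: "(\<lambda>x. 0) \<in> bimaps L A"
  unfolding bimaps_def zero_fun_def[symmetric] by (rule addcl_zero)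

lemma bimaps_sum: "(\<And>i. i \<in> I \<Longrightarrow> f i \<in> bimaps L A) \<Longrightarrow> (\<lambda>x. \<Sum>i\<in>I. f i x) \<in> bimaps L A"
proof (induction I rule: infinite_finite_induct)
  case (insert i I)
  then show ?case by (auto intro: bimaps_plus)
qed (auto simp: bimaps_zero)

lemma sum_fun_apply: "(\<Sum>i\<in>I. f i) x = (\<Sum>i\<in>I. f i x)"
  by (induction I rule: infinite_finite_induct) auto

lemma bimaps_apply_sum:
  assumes "r \<in> bimaps L A"
  shows "r (\<Sum>i\<in>I. f i) = (\<Sum>i\<in>I. r (f i))"
  by (induction I rule: infinite_finite_induct) (auto simp: bimaps_additive[OF assms])

section \<open>Maximal commutative subsets and density\<close>

lemma centralizer_division_subring:
  assumes "division_subring K"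
  shows "division_subring {x \<in> K. \<forall>l\<in>L. x * l = l * x}"
proof -
  have "inverse x * l = l * inverse x" if "x * l = l * x" for x l :: 'a
    using that by (rule mult_commute_imp_mult_inverse_commute)
  moreover have "x * y * l = l * (x * y)" if "x * l = l * x" "y * l = l * y" for x y l :: 'a
    using that by (metis mult.assoc)
  ultimately show ?thesis
    using division_subringD[OF assms] unfolding division_subring_def
    by (auto simp: distrib_left distrib_right)
qed

text \<open>Zorn's lemma for commutative subsets; an element commuting with a maximal one can be
  adjoined to it. The equation says that \<open>L\<close> is its own centralizer, which makes it a
  division subring when \<open>K\<close> is one.\<close>

lemma maximal_commutative_exists:
  fixes K :: "'a::division_ring set"
  obtains L where "L = {x \<in> K. \<forall>l\<in>L. x * l = l * x}"
proof -
  let ?S = "{X. X \<subseteq> K \<and> (\<forall>x\<in>X. \<forall>y\<in>X. x * y = y * x)}"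
  have "\<exists>M\<in>?S. \<forall>X\<in>?S. M \<subseteq> X \<longrightarrow> X = M"
  proof (rule subset_Zorn')
    fix C assume C: "subset.chain ?S C"
    have "x * y = y * x" if x: "x \<in> X" "X \<in> C" and y: "y \<in> Y" "Y \<in> C" for x y X Y
    proof -
      have "X \<subseteq> Y \<or> Y \<subseteq> X" using C x y by (auto simp: subset_chain_def)
      moreover have "X \<in> ?S" "Y \<in> ?S" using C x y by (auto simp: subset_chain_def)
      ultimately show ?thesis using x y by blast
    qed
    moreover have "\<Union>C \<subseteq> K" using C by (auto simp: subset_chain_def)
    ultimately show "\<Union>C \<in> ?S" by blast
  qed
  then obtain M where M: "M \<in> ?S" and max: "\<forall>X\<in>?S. M \<subseteq> X \<longrightarrow> X = M" ..
  have "x \<in> M" if "x \<in> K" "\<forall>l\<in>M. x * l = l * x" for x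
  proof -
    have "insert x M \<in> ?S" using M that by auto
    from max[rule_format, OF this] show ?thesis by blast
  qed
  then have "M = {x \<in> K. \<forall>l\<in>M. x * l = l * x}" using M by blast
  then show thesis by (rule that)
qed

locale maximal_commutative =
  fixes K L :: "'a::division_ring set"
  assumes K: "division_subring K" and L_eq: "L = {x \<in> K. \<forall>l\<in>L. x * l = l * x}"

sublocale maximal_commutative \<subseteq> left_spans L
  by standard (subst L_eq, rule centralizer_division_subring[OF K])

context maximal_commutative
begin

lemma L_subset: "L \<subseteq> K"
  using L_eq by blast

lemma L_commute: "l \<in> L \<Longrightarrow> m \<in> L \<Longrightarrow> l * m = m * l"
  using L_eq by blast

lemma bimaps_vanish_lspan:
  assumes "r \<in> bimaps L A" and "\<And>v. v \<in> V \<Longrightarrow> r v = 0" and "x \<in> lspan L V"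
  shows "r x = 0"
  using assms(3) unfolding lspan_def
proof induction
  case (addcl_base x)
  then obtain l v where "x = l * v" "l \<in> L" "v \<in> V" by auto
  then show ?case using bimaps_linear[OF assms(1), of l v] L_commute assms(2) by simp
qed (simp_all add: bimaps_additive[OF assms(1)])

text \<open>The density theorem for the action of \<open>L \<otimes> K\<close> on \<open>K\<close>: in the induction step, a failure
  produces a scalar \<open>c\<close> with \<open>r w = c * r v\<close> for all \<open>r\<close> annihilating \<open>V\<close>; this \<open>c\<close> commutes
  with \<open>L\<close> and hence lies in \<open>L\<close>.\<close>

lemma density:
  assumes "finite V" and "V \<subseteq> K" and "w \<in> K" and "w \<notin> lspan L V"
  shows "\<exists>r\<in>bimaps L K. (\<forall>v\<in>V. r v = 0) \<and> r w = 1"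
  using assms
proof (induction V arbitrary: w rule: finite_induct)
  case empty
  then have "w \<noteq> 0" using lspan_zero by auto
  have "(\<lambda>x. 1 * x * inverse w) \<in> bimaps L K"
    using division_subringD(2)[OF L] division_subringD(7)[OF K empty(2)] by (rule bimaps_base)
  then show ?case using \<open>w \<noteq> 0\<close> by (intro bexI[of _ "\<lambda>x. 1 * x * inverse w"]) auto
next
  case (insert v V)
  have wV: "w \<notin> lspan L V" using insert.prems(3) lspan_mono[of V "insert v V" L] by blast
  show ?case
  proof (cases "v \<in> lspan L V")
    case True
    obtain r where r: "r \<in> bimaps L K" "\<forall>v\<in>V. r v = 0" "r w = 1"
      using insert.IH[OF _ insert.prems(2) wV] insert.prems(1) by auto
    then have "r v = 0" using bimaps_vanish_lspan[OF r(1) _ True] by simp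
    then show ?thesis using r by auto
  next
    case False
    obtain r0 where r0: "r0 \<in> bimaps L K" "\<forall>v\<in>V. r0 v = 0" "r0 v = 1"
      using insert.IH[of v] False insert.prems(1) by auto
    let ?c = "r0 w"
    show ?thesis
    proof (rule ccontr)
      assume neg: "\<not> ?thesis"
      have kill: "r w = 0" if r: "r \<in> bimaps L K" "\<forall>u\<in>insert v V. r u = 0" for r
      proof (rule ccontr)
        assume nz: "r w \<noteq> 0"
        have "r w \<in> K" by (rule bimaps_closed[OF K L_subset subset_refl r(1) insert.prems(2)])
        then have "(\<lambda>x. r x * inverse (r w)) \<in> bimaps L K"
          by (intro bimaps_mult_right[OF r(1)] division_subringD[OF K])
        moreover have "r w * inverse (r w) = 1" using nz by simp
        ultimately show False using neg r(2) by force
      qed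
      \<comment> \<open>Adding \<open>r0\<close> followed by right multiplication by
        \<open>- r v\<close> makes the map vanish at \<open>v\<close> too, so \<open>kill\<close>
        applies.\<close>
      have factor: "r w = ?c * r v" if r: "r \<in> bimaps L K" "\<forall>u\<in>V. r u = 0" for r
      proof -
        have rv: "r v \<in> K"
          by (rule bimaps_closed[OF K L_subset subset_refl r(1)]) (use insert.prems(1) in auto)
        have "(\<lambda>x. r0 x * (- r v)) \<in> bimaps L K"
          using rv by (intro bimaps_mult_right[OF r0(1)] division_subringD[OF K])
        from bimaps_plus[OF r(1) this] have "r w + r0 w * (- r v) = 0"
          by (rule kill) (use r r0 in auto)
        then show ?thesis by simp
      qed
      have "?c * l = l * ?c" if "l \<in> L" for l
      proof -
        have "(\<lambda>x. l * r0 x) \<in> bimaps L K"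
          using that by (intro bimaps_mult_left[OF r0(1)] division_subringD(4)[OF L])
        from factor[OF this] show ?thesis using r0 by simp
      qed
      moreover have "?c \<in> K"
        by (rule bimaps_closed[OF K L_subset subset_refl r0(1) insert.prems(2)])
      ultimately have cL: "?c \<in> L" by (subst L_eq) blast
      \<comment> \<open>\<open>?w\<close> lies outside the span of \<open>V\<close>, yet by
        \<open>factor\<close> every map in \<open>bimaps L K\<close> that annihilates
        \<open>V\<close> also annihilates \<open>?w\<close>.\<close>
      let ?w = "w - ?c * v"
      have "?w \<notin> lspan L V"
      proof
        assume "?w \<in> lspan L V"
        then have "?w \<in> lspan L (insert v V)" using lspan_mono[of V "insert v V" L] by blast
        then have "?w + ?c * v \<in> lspan L (insert v V)"
          using lspan_base[OF cL] by (intro lspan_add) auto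
        then show False using insert.prems(3) by simp
      qed
      moreover have "?w \<in> K" "V \<subseteq> K"
        using insert.prems \<open>?c \<in> K\<close> by (auto intro!: division_subringD(4,6)[OF K])
      ultimately obtain r where r: "r \<in> bimaps L K" "\<forall>u\<in>V. r u = 0" "r ?w = 1"
        using insert.IH[of ?w] by blast
      have "r (?c * v) = ?c * r v" by (rule bimaps_linear[OF r(1) L_commute[OF cL]])
      then have "r ?w = 0" using factor[OF r(1,2)] by (simp add: bimaps_additive[OF r(1)])
      then show False using r(3) by simp
    qed
  qed
qed

end

text \<open>If some \<open>k i\<close> is not central, say \<open>k i * c \<noteq> c * k i\<close>, then comparing the expressions for
  \<open>c * y * x\<close> eliminates the index \<open>i\<close>.\<close>

lemma bimap_right_mult_central_span:
  fixes K :: "'a::division_ring set"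
  assumes K: "division_subring K" and "finite I" and "\<And>i. i \<in> I \<Longrightarrow> k i \<in> K"
    and "\<And>y. y \<in> K \<Longrightarrow> y * x = (\<Sum>i\<in>I. k i * y * b i)"
  shows "x \<in> lspan (center_of K) (b ` I)"
  using assms(2-)
proof (induction I arbitrary: k rule: finite_psubset_induct)
  case (psubset I)
  show ?case
  proof (cases "\<forall>i\<in>I. k i \<in> center_of K")
    case True
    have "x = (\<Sum>i\<in>I. k i * b i)" using psubset.prems(2)[OF division_subringD(2)[OF K]] by simp
    also have "\<dots> \<in> lspan (center_of K) (b ` I)"
      using True by (intro lspan_sum) (auto simp: lspan_def intro!: addcl_base)
    finally show ?thesis .
  next
    case False
    then obtain j where j: "j \<in> I" "k j \<notin> center_of K" by blast
    then obtain c where c: "c \<in> K" "k j * c \<noteq> c * k j"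
      using psubset.prems(1) unfolding center_of_def by blast
    \<comment> \<open>Computing \<open>c * y * x\<close> in two ways shows that the sum of the terms
      \<open>e i * y * b i\<close> vanishes, while \<open>e j\<close> is nonzero.\<close>
    define e where "e i = k i * c - c * k i" for i
    have eK: "e i \<in> K" if "i \<in> I" for i
      unfolding e_def using that c psubset.prems(1) by (intro division_subringD(4,6)[OF K])
    have ej: "e j \<noteq> 0" using c by (simp add: e_def)
    \<comment> \<open>The multiple of this relation is chosen to make \<open>k' j\<close>
      zero.\<close>
    define k' where "k' i = k i - k j * inverse (e j) * e i" for i
    have "x \<in> lspan (center_of K) (b ` (I - {j}))"
    proof (rule psubset.IH[of _ k'])
      show "I - {j} \<subset> I" using j by blast
      show "k' i \<in> K" if "i \<in> I - {j}" for i
        unfolding k'_def using that j eK psubset.prems(1)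
        by (intro division_subringD(4,6,7)[OF K]) auto
    next
      fix y assume y: "y \<in> K"
      have "(\<Sum>i\<in>I. k i * (c * y) * b i) = c * (\<Sum>i\<in>I. k i * y * b i)"
        using psubset.prems(2)[OF division_subringD(4)[OF K c(1) y]] psubset.prems(2)[OF y]
        by (simp add: mult.assoc)
      then have "(\<Sum>i\<in>I. e i * y * b i) = 0"
        by (simp add: e_def left_diff_distrib sum_subtractf sum_distrib_left mult.assoc)
      then have "k j * inverse (e j) * (\<Sum>i\<in>I. e i * y * b i) = 0" by simp
      then have "(\<Sum>i\<in>I. k j * inverse (e j) * e i * y * b i) = 0"
        by (simp add: sum_distrib_left mult.assoc)
      then have "y * x = (\<Sum>i\<in>I. k' i * y * b i)"
        using psubset.prems(2)[OF y] by (simp add: k'_def left_diff_distrib sum_subtractf)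
      also have "\<dots> = (\<Sum>i\<in>I - {j}. k' i * y * b i)"
        using ej by (intro sum.mono_neutral_right psubset.hyps) (auto simp: k'_def mult.assoc)
      finally show "y * x = (\<Sum>i\<in>I - {j}. k' i * y * b i)" .
    qed
    then show ?thesis using lspan_mono[of "b ` (I - {j})" "b ` I"] by blast
  qed
qed

lemma center_of_division_subring:
  assumes "division_subring K"
  shows "division_subring (center_of K)"
  unfolding center_of_def by (rule centralizer_division_subring[OF assms])

lemma centrally_finite_iff:
  assumes "division_subring K"
  shows "centrally_finite K \<longleftrightarrow> (\<exists>B. finite B \<and> B \<subseteq> K \<and> K \<subseteq> lspan (center_of K) B)"
proof
  assume "centrally_finite K"
  then obtain B where B: "finite B" "B \<subseteq> K"
    "\<forall>x\<in>K. \<exists>c. (\<forall>b\<in>B. c b \<in> center_of K) \<and> x = (\<Sum>b\<in>B. c b * b)"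
    unfolding centrally_finite_def by blast
  have "K \<subseteq> lspan (center_of K) B"
  proof
    fix x assume "x \<in> K"
    then obtain c where c: "\<forall>b\<in>B. c b \<in> center_of K" "x = (\<Sum>b\<in>B. c b * b)" using B(3) by blast
    show "x \<in> lspan (center_of K) B"
      unfolding c(2) using c(1) by (intro lspan_sum) (auto simp: lspan_def intro!: addcl_base)
  qed
  then show "\<exists>B. finite B \<and> B \<subseteq> K \<and> K \<subseteq> lspan (center_of K) B" using B by blast
next
  assume "\<exists>B. finite B \<and> B \<subseteq> K \<and> K \<subseteq> lspan (center_of K) B"
  then obtain B where B: "finite B" "B \<subseteq> K" "K \<subseteq> lspan (center_of K) B" by blast
  have "\<exists>c. (\<forall>b\<in>B. c b \<in> center_of K) \<and> x = (\<Sum>b\<in>B. c b * b)" if "x \<in> K" for x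
    by (rule addcl_indexed_sum)
       (use that B division_subringD(1,3)[OF center_of_division_subring[OF assms]] in
         \<open>auto simp: lspan_def distrib_right\<close>)
  then show "centrally_finite K" using B unfolding centrally_finite_def by blast
qed

context maximal_commutative
begin

text \<open>A finite spanning set \<open>V\<close> over \<open>L\<close> with dual basis \<open>e v\<close> in \<open>L \<otimes> K\<close> makes right
  multiplication by any \<open>x\<close> a combination of the maps \<open>y \<mapsto> k * y * b\<close> with \<open>b\<close> ranging over a
  finite set that does not depend on \<open>x\<close>.\<close>

lemma centrally_finite_if_finite_dim:
  assumes "finite V" and "V \<subseteq> K" and "K \<subseteq> lspan L V"
  shows "centrally_finite K"
proof -
  \<comment> \<open>A spanning set of least cardinality is a basis: no member lies in the span of
    the others.\<close>
  let ?spans = "\<lambda>V. finite V \<and> V \<subseteq> K \<and> K \<subseteq> lspan L V"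
  have "\<exists>V. ?spans V \<and> (\<forall>W. ?spans W \<longrightarrow> card V \<le> card W)"
    using assms by (intro ex_has_least_nat[of ?spans V]) simp
  then obtain V where V: "finite V" "V \<subseteq> K" "K \<subseteq> lspan L V"
    and least: "\<forall>W. ?spans W \<longrightarrow> card V \<le> card W" by (elim exE conjE)
  have indep: "v \<notin> lspan L (V - {v})" if "v \<in> V" for v
  proof
    assume "v \<in> lspan L (V - {v})"
    then have "V \<subseteq> lspan L (V - {v})" using lspan_superset[of "V - {v}"] by blast
    then have "K \<subseteq> lspan L (V - {v})" using V(3) lspan_subsetI by blast
    then have "card V \<le> card (V - {v})" using V least by auto
    then show False using card_Diff1_less[OF V(1) that] by simp
  qed
  have "\<forall>v\<in>V. \<exists>r. r \<in> bimaps L K \<and> (\<forall>u\<in>V - {v}. r u = 0) \<and> r v = 1"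
  proof
    fix v assume v: "v \<in> V"
    have "\<exists>r\<in>bimaps L K. (\<forall>u\<in>V - {v}. r u = 0) \<and> r v = 1"
      using V(1,2) v by (intro density indep) auto
    then show "\<exists>r. r \<in> bimaps L K \<and> (\<forall>u\<in>V - {v}. r u = 0) \<and> r v = 1" by blast
  qed
  from bchoice[OF this] obtain e where
    e0: "\<forall>v\<in>V. e v \<in> bimaps L K \<and> (\<forall>u\<in>V - {v}. e v u = 0) \<and> e v v = 1" ..
  have e: "e v \<in> bimaps L K" "u \<in> V \<Longrightarrow> e v u = (if u = v then 1 else 0)" if "v \<in> V" for u v
    using e0 that by auto
  have "\<forall>v\<in>V. \<exists>X. finite X \<and> X \<subseteq> K \<and> e v \<in> bimaps L X"
    using e(1) bimaps_finite_support by blast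
  then obtain X where X: "\<And>v. v \<in> V \<Longrightarrow> finite (X v)" "\<And>v. v \<in> V \<Longrightarrow> X v \<subseteq> K"
    "\<And>v. v \<in> V \<Longrightarrow> e v \<in> bimaps L (X v)" using bchoice[of V] by metis
  define B where "B = (\<lambda>(a, w). a * w) ` ((\<Union>v\<in>V. X v) \<times> V)"
  have finB: "finite B" unfolding B_def using V(1) X(1) by auto
  have BK: "B \<subseteq> K" unfolding B_def using V(2) X(2) by (auto intro!: division_subringD(4)[OF K] dest!: subsetD)
  have coords: "\<exists>m. (\<forall>w\<in>V. m w \<in> L) \<and> x = (\<Sum>w\<in>V. m w * w)" if "x \<in> K" for x
    by (rule addcl_indexed_sum)
       (use that V division_subringD(1,3)[OF L] in \<open>auto simp: lspan_def distrib_right\<close>)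
  have "x \<in> lspan (center_of K) B" if x: "x \<in> K" for x
  proof -
    have "\<forall>v\<in>V. \<exists>m. (\<forall>w\<in>V. m w \<in> L) \<and> v * x = (\<Sum>w\<in>V. m w * w)"
      using coords division_subringD(4)[OF K _ x] V(2) by blast
    then obtain m where m: "\<And>v w. v \<in> V \<Longrightarrow> w \<in> V \<Longrightarrow> m v w \<in> L"
      "\<And>v. v \<in> V \<Longrightarrow> v * x = (\<Sum>w\<in>V. m v w * w)" by metis
    \<comment> \<open>For \<open>y\<close> in \<open>K\<close>, the \<open>e v y\<close> are the
      coordinates of \<open>y\<close> and the \<open>m v w\<close> those of \<open>v * x\<close>, so
      \<open>g y\<close> is \<open>y * x\<close>.\<close>
    define g where "g y = (\<Sum>v\<in>V. \<Sum>w\<in>V. m v w * e v y * w)" for y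
    have "g \<in> bimaps K B"
      unfolding g_def
    proof (intro bimaps_sum)
      fix v w assume vw: "v \<in> V" "w \<in> V"
      have "(\<lambda>y. m v w * e v y) \<in> bimaps K (X v)"
        by (rule bimaps_mult_left[OF X(3)[OF vw(1)]], rule division_subringD(4)[OF K])
           (use m(1)[OF vw] L_subset in auto)
      then show "(\<lambda>y. m v w * e v y * w) \<in> bimaps K B"
        by (rule bimaps_mult_right) (use vw in \<open>auto simp: B_def\<close>)
    qed
    then have "\<exists>k. (\<forall>b\<in>B. k b \<in> K) \<and> g = (\<Sum>b\<in>B. (\<lambda>y. k b * y * b))"
      unfolding bimaps_def
      by (rule addcl_indexed_sum)
         (use finB division_subringD(1,3)[OF K] in \<open>auto simp: distrib_right fun_eq_iff\<close>)
    then obtain k where k: "\<forall>b\<in>B. k b \<in> K" "g = (\<Sum>b\<in>B. (\<lambda>y. k b * y * b))" by blast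
    have "y * x = (\<Sum>b\<in>B. k b * y * b)" if "y \<in> K" for y
    proof -
      obtain l where l: "\<And>v. v \<in> V \<Longrightarrow> l v \<in> L" "y = (\<Sum>v\<in>V. l v * v)" using coords[OF \<open>y \<in> K\<close>] by blast
      have ey: "e v y = l v" if v: "v \<in> V" for v
      proof -
        have "e v y = (\<Sum>u\<in>V. e v (l u * u))"
          unfolding l(2) by (rule bimaps_apply_sum[OF e(1)[OF v]])
        also have "\<dots> = (\<Sum>u\<in>V. if u = v then l v else 0)"
        proof (rule sum.cong[OF refl])
          fix u assume u: "u \<in> V"
          have "e v (l u * u) = l u * e v u"
            by (rule bimaps_linear[OF e(1)[OF v] L_commute[OF l(1)[OF u]]])
          then show "e v (l u * u) = (if u = v then l v else 0)" using e(2)[OF v u] by simp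
        qed
        also have "\<dots> = l v" using v V(1) by simp
        finally show ?thesis .
      qed
      have "y * x = (\<Sum>v\<in>V. l v * (v * x))"
        unfolding l(2) by (simp add: sum_distrib_right mult.assoc)
      also have "\<dots> = (\<Sum>v\<in>V. \<Sum>w\<in>V. l v * m v w * w)"
        by (rule sum.cong[OF refl]) (simp add: m(2) sum_distrib_left mult.assoc)
      also have "\<dots> = g y"
        unfolding g_def by (intro sum.cong refl) (simp add: ey L_commute[OF l(1) m(1)])
      finally show ?thesis by (simp add: k(2) sum_fun_apply)
    qed
    then have "x \<in> lspan (center_of K) ((\<lambda>b. b) ` B)"
      using k(1) by (intro bimap_right_mult_central_span[OF K finB, of k]) blast+
    then show ?thesis by simp
  qed
  then show ?thesis using finB BK centrally_finite_iff[OF K] by blast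
qed

end

section \<open>Division rings generated by a domain with a polynomial identity\<close>

text \<open>Sorting the monomials by first letter gives a relation between the \<open>y i\<close>,
  the coefficients \<open>q\<close> being moved past that letter. Independence turns it into
  identities with one letter fewer.\<close>

lemma right_independent_imp_free:
  fixes y :: "nat \<Rightarrow> 'a::ring_1"
  assumes A: "0 \<in> A" "1 \<in> A" "\<And>a b. a \<in> A \<Longrightarrow> b \<in> A \<Longrightarrow> a + b \<in> A"
      "\<And>a b. a \<in> A \<Longrightarrow> b \<in> A \<Longrightarrow> a * b \<in> A"
    and y: "\<And>i. y i \<in> A"
    and indep: "\<And>J c. finite J \<Longrightarrow> (\<And>i. i \<in> J \<Longrightarrow> c i \<in> A) \<Longrightarrow> (\<Sum>i\<in>J. y i * c i) = 0 \<Longrightarrow>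
      \<forall>i\<in>J. c i = 0"
    and "finite I"
    and "\<And>u. q u \<in> A" and "\<And>u a. a \<in> A \<Longrightarrow> q u * a = a * q u"
    and "(\<Sum>u\<in>permutations_of_set I. q u * prod_list (map y u)) = 0"
    and "u \<in> permutations_of_set I"
  shows "q u = 0"
  using assms(7-)
proof (induction I arbitrary: q u rule: finite_psubset_induct)
  case (psubset I)
  show ?case
  proof (cases "I = {}")
    case True
    then show ?thesis using psubset.prems by simp
  next
    case False
    have prodA: "prod_list (map y v) \<in> A" for v by (induction v) (auto intro: A y)
    let ?c = "\<lambda>i. \<Sum>v\<in>permutations_of_set (I - {i}). q (i # v) * prod_list (map y v)"
    have cA: "?c i \<in> A" for i
    proof -
      have "sum h S \<in> A" if "\<And>x. h x \<in> A" for h :: "nat list \<Rightarrow> 'a" and S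
        by (induction S rule: infinite_finite_induct) (auto intro: A that)
      then show ?thesis by (simp add: A prodA psubset.prems(1))
    qed
    have "(\<Sum>i\<in>I. y i * ?c i) = (\<Sum>v\<in>permutations_of_set I. q v * prod_list (map y v))"
      unfolding sum_permutations_of_set[OF psubset.hyps False] sum_distrib_left
    proof (intro sum.cong refl)
      fix i v
      have "q (i # v) * y i = y i * q (i # v)" by (rule psubset.prems(2)[OF y])
      then show "y i * (q (i # v) * prod_list (map y v)) = q (i # v) * prod_list (map y (i # v))"
        by (simp flip: mult.assoc)
    qed
    then have c0: "\<forall>i\<in>I. ?c i = 0" using psubset.prems(3) by (intro indep psubset.hyps cA) simp
    obtain i v where u: "u = i # v" "i \<in> I" "v \<in> permutations_of_set (I - {i})"
      using psubset.prems(4) unfolding permutations_of_set_nonempty[OF False] by blast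
    have "q (i # v) = 0"
      by (rule psubset.IH[where q = "\<lambda>v. q (i # v)", OF _ psubset.prems(1,2) c0[rule_format] u(3)])
         (use u in auto)
    then show ?thesis using u by simp
  qed
qed

text \<open>For an initial segment of exponents the relation reads \<open>a * c 0 = b * d\<close>
  with \<open>d\<close> in \<open>A\<close>. Hence \<open>c 0 = 0\<close>, \<open>b\<close> cancels,
  and a shorter relation of the same kind remains.\<close>

lemma powers_right_independent:
  fixes a b :: "'a::division_ring"
  assumes A: "0 \<in> A" "\<And>x y. x \<in> A \<Longrightarrow> y \<in> A \<Longrightarrow> x + y \<in> A"
      "\<And>x y. x \<in> A \<Longrightarrow> y \<in> A \<Longrightarrow> x * y \<in> A" "\<And>x. x \<in> A \<Longrightarrow> - x \<in> A" "1 \<in> A"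
    and "a \<in> A" and "b \<in> A" and "b \<noteq> 0"
    and no_common: "\<And>c d. c \<in> A \<Longrightarrow> d \<in> A \<Longrightarrow> a * c = b * d \<Longrightarrow> c = 0"
    and "finite J" and "\<And>i. i \<in> J \<Longrightarrow> c i \<in> A" and "(\<Sum>i\<in>J. b ^ i * a * c i) = 0"
  shows "\<forall>i\<in>J. c i = 0"
proof -
  have powA: "b ^ i \<in> A" for i by (induction i) (auto intro: A assms)
  have initial: "\<forall>i<n. c i = 0"
    if "\<And>i. c i \<in> A" "(\<Sum>i<n. b ^ i * a * c i) = 0" for n and c :: "nat \<Rightarrow> 'a"
    using that
  proof (induction n arbitrary: c)
    case (Suc n)
    let ?s = "\<Sum>i<n. b ^ i * a * c (Suc i)"
    have sA: "?s \<in> A"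
      by (induction n) (auto intro!: A powA Suc.prems(1) assms)
    have "a * c 0 + b * ?s = 0"
      using Suc.prems(2) by (simp add: sum.lessThan_Suc_shift sum_distrib_left mult.assoc del: sum.lessThan_Suc)
    then have eq: "a * c 0 = b * (- ?s)" by (simp add: eq_neg_iff_add_eq_0)
    then have c0: "c 0 = 0" by (rule no_common[OF Suc.prems(1) A(4)[OF sA]])
    with eq have "?s = 0" using \<open>b \<noteq> 0\<close> by simp
    then have "\<forall>i<n. c (Suc i) = 0" by (intro Suc.IH Suc.prems(1))
    then show ?case using c0 less_Suc_eq_0_disj by auto
  qed simp
  obtain n where n: "J \<subseteq> {..<n}" using \<open>finite J\<close> unfolding finite_nat_set_iff_bounded by blast
  let ?c = "\<lambda>i. if i \<in> J then c i else 0"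
  have "(\<Sum>i<n. b ^ i * a * ?c i) = (\<Sum>i\<in>J. b ^ i * a * c i)"
    by (rule sum.mono_neutral_cong_right) (use n in auto)
  then have "\<forall>i<n. ?c i = 0" using assms(11,12) A(1) by (intro initial) auto
  then show ?thesis using n by (metis lessThan_iff subsetD)
qed

text \<open>The division ring \<open>K\<close> is generated by \<open>A\<close>. Two instances are
  used: \<open>F[S]\<close> with the division ring generated by it, and a division ring in the role
  of both \<open>A\<close> and \<open>K\<close>.\<close>

locale multilinear_identity =
  fixes K A :: "'a::division_ring set" and I :: "nat set" and q :: "nat list \<Rightarrow> 'a" and u0
  assumes K: "division_subring K" and A_K: "A \<subseteq> K"
    and A: "0 \<in> A" "1 \<in> A" "\<And>x y. x \<in> A \<Longrightarrow> y \<in> A \<Longrightarrow> x + y \<in> A"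
      "\<And>x y. x \<in> A \<Longrightarrow> y \<in> A \<Longrightarrow> x * y \<in> A" "\<And>x. x \<in> A \<Longrightarrow> - x \<in> A"
    and generates: "\<And>K'. division_subring K' \<Longrightarrow> A \<subseteq> K' \<Longrightarrow> K \<subseteq> K'"
    and finite_I: "finite I"
    and q_A: "\<And>u. q u \<in> A" and q_central: "\<And>u x. x \<in> K \<Longrightarrow> q u * x = x * q u"
    and u0: "u0 \<in> permutations_of_set I" "q u0 \<noteq> 0"
    and identity: "\<And>y. (\<And>i. y i \<in> A) \<Longrightarrow>
      (\<Sum>u\<in>permutations_of_set I. q u * prod_list (map y u)) = 0"
begin

text \<open>Otherwise the elements \<open>b ^ i * a\<close> would be right independent over
  \<open>A\<close>, and the identity could have only zero coefficients.\<close>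

lemma ore:
  assumes a: "a \<in> A" and b: "b \<in> A" "b \<noteq> 0"
  shows "\<exists>c\<in>A. \<exists>d\<in>A. c \<noteq> 0 \<and> a * c = b * d"
proof (rule ccontr)
  assume "\<not> ?thesis"
  then have no_common: "\<And>c d. c \<in> A \<Longrightarrow> d \<in> A \<Longrightarrow> a * c = b * d \<Longrightarrow> c = 0" by blast
  have powA: "b ^ i * a \<in> A" for i by (induction i) (auto simp: mult.assoc intro: A a b)
  have "q u0 = 0"
  proof (rule right_independent_imp_free[where A = A and y = "\<lambda>i. b ^ i * a" and I = I])
    show "\<forall>i\<in>J. c i = 0"
      if "finite J" "\<And>i. i \<in> J \<Longrightarrow> c i \<in> A" "(\<Sum>i\<in>J. b ^ i * a * c i) = 0" for J c
      by (rule powers_right_independent[OF A(1,3,4,5,2) a b no_common that])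
    show "q u * x = x * q u" if "x \<in> A" for u x using that A_K q_central by blast
    show "(\<Sum>u\<in>permutations_of_set I. q u * prod_list (map (\<lambda>i. b ^ i * a) u)) = 0"
      by (rule identity) (rule powA)
  qed (simp_all add: A powA finite_I q_A u0)
  then show False using u0 by simp
qed

text \<open>The elements with a right denominator in \<open>A\<close> form a division subring
  containing \<open>A\<close>, hence all of \<open>K\<close>.\<close>

lemma fractions:
  assumes "x \<in> K"
  shows "\<exists>b\<in>A. b \<noteq> 0 \<and> x * b \<in> A"
proof -
  let ?Q = "{x \<in> K. \<exists>b\<in>A. b \<noteq> 0 \<and> x * b \<in> A}"
  have "division_subring ?Q"
    unfolding division_subring_def
  proof (intro conjI ballI impI)
    show "0 \<in> ?Q" "1 \<in> ?Q" using A division_subringD(1,2)[OF K] by (auto intro!: bexI[of _ 1])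
  next
    fix x y assume xy: "x \<in> ?Q" "y \<in> ?Q"
    obtain b where b: "b \<in> A" "b \<noteq> 0" "x * b \<in> A" using xy(1) by blast
    obtain c where c: "c \<in> A" "c \<noteq> 0" "y * c \<in> A" using xy(2) by blast
    obtain s t where st: "s \<in> A" "t \<in> A" "s \<noteq> 0" "b * s = c * t" using ore[OF b(1) c(1,2)] by blast
    have "(x + y) * (b * s) = x * b * s + y * c * t"
      by (simp only: distrib_right mult.assoc st(4))
    then have "(x + y) * (b * s) \<in> A" "b * s \<in> A" "b * s \<noteq> 0" using A b c st by auto
    then show "x + y \<in> ?Q" using xy division_subringD(3)[OF K] by blast
    \<comment> \<open>For a product the Ore condition is applied to the numerator of
      \<open>y\<close> and the denominator of \<open>x\<close>.\<close>
    obtain s t where st: "s \<in> A" "t \<in> A" "s \<noteq> 0" "y * c * s = b * t" using ore[OF c(3) b(1,2)] by blast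
    have "x * y * (c * s) = x * b * t" by (simp only: mult.assoc st(4)[symmetric])
    then have "x * y * (c * s) \<in> A" "c * s \<in> A" "c * s \<noteq> 0" using A b c st by auto
    then show "x * y \<in> ?Q" using xy division_subringD(4)[OF K] by blast
  next
    fix x assume "x \<in> ?Q"
    then obtain b where "x \<in> K" "b \<in> A" "b \<noteq> 0" "x * b \<in> A" by blast
    then have "- x * b \<in> A" using A(5)[of "x * b"] by simp
    then show "- x \<in> ?Q" using \<open>x \<in> K\<close> \<open>b \<in> A\<close> \<open>b \<noteq> 0\<close> division_subringD(5)[OF K] by blast
  next
    fix x assume "x \<in> ?Q" "x \<noteq> 0"
    then obtain b where b: "x \<in> K" "b \<in> A" "b \<noteq> 0" "x * b \<in> A" by blast
    have "inverse x * (x * b) = b" using \<open>x \<noteq> 0\<close> by (simp flip: mult.assoc)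
    then have "inverse x * (x * b) \<in> A" "x * b \<noteq> 0" using b \<open>x \<noteq> 0\<close> by auto
    then show "inverse x \<in> ?Q" using b division_subringD(7)[OF K] by blast
  qed
  moreover have "A \<subseteq> ?Q" using A A_K by (auto intro!: bexI[of _ 1])
  ultimately show ?thesis using generates[of ?Q] assms by blast
qed

lemma common_denominator:
  assumes "finite X" and "X \<subseteq> K"
  shows "\<exists>b\<in>A. b \<noteq> 0 \<and> (\<forall>x\<in>X. x * b \<in> A)"
  using assms
proof (induction X rule: finite_induct)
  case empty
  then show ?case using A(2) by (intro bexI[of _ 1]) auto
next
  case (insert x X)
  then obtain b where b: "b \<in> A" "b \<noteq> 0" "\<And>x. x \<in> X \<Longrightarrow> x * b \<in> A" by auto
  obtain c where c: "c \<in> A" "c \<noteq> 0" "x * c \<in> A" using fractions insert.prems by blast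
  obtain s t where st: "s \<in> A" "t \<in> A" "s \<noteq> 0" "b * s = c * t" using ore[OF b(1) c(1,2)] by blast
  have "z * (b * s) \<in> A" if "z \<in> X" for z
    using A(4)[OF b(3)[OF that] st(1)] by (simp only: mult.assoc)
  moreover have "x * (b * s) \<in> A" using A(4)[OF c(3) st(2)] by (simp only: mult.assoc st(4))
  moreover have "b * s \<in> A" "b * s \<noteq> 0" using A(4)[OF b(1) st(1)] b(2) st(3) by simp_all
  ultimately show ?case by (intro bexI[of _ "b * s"]) auto
qed

end

section \<open>The action of the tensor product of \<open>L\<close> and \<open>A\<close> on
  \<open>K\<close>\<close>

locale multilinear_identity_max = multilinear_identity K A I q u0 + maximal_commutative K L
  for K A :: "'a::division_ring set" and I q u0 L
begin

lemma bimaps_common_denominator: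
  assumes "r \<in> bimaps L K"
  shows "\<exists>b\<in>A. b \<noteq> 0 \<and> (\<lambda>x. r x * b) \<in> bimaps L A"
proof -
  obtain X where X: "finite X" "X \<subseteq> K" "r \<in> bimaps L X" using bimaps_finite_support[OF assms] by blast
  obtain b where "b \<in> A" "b \<noteq> 0" "\<And>x. x \<in> X \<Longrightarrow> x * b \<in> A" using common_denominator[OF X(1,2)] by blast
  then show ?thesis using bimaps_mult_right[OF X(3)] by blast
qed

text \<open>For maps \<open>x \<mapsto> l * x * a\<close> the left factors commute, so every
  monomial yields the same left factor and the identity of \<open>A\<close> remains on the
  right.\<close>

lemma bimaps_identity:
  assumes "\<And>i. r i \<in> bimaps L A" and "w \<in> K"
  shows "(\<Sum>u\<in>permutations_of_set I. q u * foldl (\<lambda>x i. r i x) w u) = 0"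
proof (rule multilinear_vanishes_addcl[OF finite_I, where G = "{\<lambda>x. l * x * a |l a. l \<in> L \<and> a \<in> A}"])
  show "r i \<in> addcl {\<lambda>x. l * x * a |l a. l \<in> L \<and> a \<in> A}" for i using assms(1) by (simp add: bimaps_def)
  show "{\<lambda>x. l * x * a |l a. l \<in> L \<and> a \<in> A} \<noteq> {}" using A(1) division_subringD(1)[OF L] by blast
  show "g (x + y) = g x + g y" if "g \<in> {\<lambda>x. l * x * a |l a. l \<in> L \<and> a \<in> A}" for g x y
    using that by (auto simp: distrib_left distrib_right)
next
  fix r :: "nat \<Rightarrow> 'a \<Rightarrow> 'a" assume "\<And>i. r i \<in> {\<lambda>x. l * x * a |l a. l \<in> L \<and> a \<in> A}"
  then have "\<forall>i. \<exists>l a. l \<in> L \<and> a \<in> A \<and> r i = (\<lambda>x. l * x * a)" by blast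
  then obtain l a where r: "\<And>i. l i \<in> L" "\<And>i. a i \<in> A" "\<And>i. r i = (\<lambda>x. l i * x * a i)" by metis
  have foldl: "foldl (\<lambda>x i. r i x) w u = prod_list (map l (rev u)) * w * prod_list (map a u)" for u w
    by (induction u arbitrary: w) (auto simp: r(3) mult.assoc)
  let ?l = "prod_list (map l (rev u0))"
  have lL: "?l \<in> K"
  proof -
    have "prod_list (map l v) \<in> L" for v
      by (induction v) (auto intro: r(1) division_subringD(2,4)[OF L])
    then show ?thesis using L_subset by blast
  qed
  have "q u * foldl (\<lambda>x i. r i x) w u = ?l * w * (q u * prod_list (map a u))"
    if u: "u \<in> permutations_of_set I" for u
  proof -
    have "mset (rev u) = mset (rev u0)"
      using u u0(1) by (intro set_eq_iff_mset_eq_distinct[THEN iffD1]) (auto dest: permutations_of_setD)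
    then have "prod_list (map l (rev u)) = ?l"
      by (rule prod_list_map_commuting) (rule L_commute[OF r(1) r(1)])
    moreover have "q u * (?l * w) = ?l * w * q u"
      by (rule q_central) (use division_subringD(4)[OF K] lL assms(2) in blast)
    ultimately show ?thesis by (simp add: foldl flip: mult.assoc)
  qed
  then have "(\<Sum>u\<in>permutations_of_set I. q u * foldl (\<lambda>x i. r i x) w u) =
      ?l * w * (\<Sum>u\<in>permutations_of_set I. q u * prod_list (map a u))"
    by (simp add: sum_distrib_left)
  then show "(\<Sum>u\<in>permutations_of_set I. q u * foldl (\<lambda>x i. r i x) w u) = 0"
    using identity[of a] r(2) by simp
qed

text \<open>Density only provides a map in \<open>L \<otimes> K\<close>; clearing denominators moves it into \<open>L \<otimes> A\<close>, and
  infinite dimension leaves room to choose its value at \<open>w\<close> outside the given finite span.\<close>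

lemma escaping_bimap:
  assumes infinite_dim: "\<And>V. finite V \<Longrightarrow> V \<subseteq> K \<Longrightarrow> \<not> K \<subseteq> lspan L V"
    and T: "finite T" "T \<subseteq> K" and w: "w \<in> K" "w \<notin> lspan L T"
  shows "\<exists>r\<in>bimaps L A. (\<forall>v\<in>T. r v = 0) \<and> r w \<in> K \<and> r w \<notin> lspan L (insert w T)"
proof -
  obtain r0 where r0: "r0 \<in> bimaps L K" "\<forall>v\<in>T. r0 v = 0" "r0 w = 1"
    using density[OF T w] by blast
  obtain b where b: "b \<in> A" "b \<noteq> 0" "(\<lambda>x. r0 x * b) \<in> bimaps L A"
    using bimaps_common_denominator[OF r0(1)] by blast
  \<comment> \<open>One vector more than \<open>insert w T\<close> has: after right multiplication
    by a nonzero \<open>c\<close> they stay independent and cannot all lie in its span.\<close>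
  obtain xs where xs: "length xs = Suc (card (insert w T))" "set xs \<subseteq> K" "independent xs"
    using infinite_dim_independent[OF infinite_dim] by blast
  have "(\<lambda>x. inverse b * x) ` set xs \<subseteq> K"
  proof -
    have "b \<in> K" using b(1) A_K by blast
    then show ?thesis using xs(2) division_subringD(4,7)[OF K] by blast
  qed
  \<comment> \<open>Denominators are cleared for \<open>inverse b * x\<close> rather than
    \<open>x\<close>: the new right factor lies in \<open>A\<close>, and the \<open>b\<close> in
    front of it cancels to give the value \<open>x * c\<close> at \<open>w\<close>.\<close>
  then obtain c where c: "c \<in> A" "c \<noteq> 0" "\<And>x. x \<in> set xs \<Longrightarrow> inverse b * x * c \<in> A"
    using common_denominator[of "(\<lambda>x. inverse b * x) ` set xs"] by auto
  have "\<exists>x\<in>set xs. x * c \<notin> lspan L (insert w T)"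
  proof (rule ccontr)
    assume "\<not> ?thesis"
    then have "set (map (\<lambda>x. x * c) xs) \<subseteq> lspan L (insert w T)" by auto
    from independent_length_le[OF independent_mult_right[OF c(2) xs(3)] this]
    show False using T(1) xs(1) by simp
  qed
  then obtain x where x: "x \<in> set xs" "x * c \<notin> lspan L (insert w T)" by blast
  let ?r = "\<lambda>z. r0 z * b * (inverse b * x * c)"
  have "?r \<in> bimaps L A" by (rule bimaps_mult_right[OF b(3)]) (rule A(4)[OF _ c(3)[OF x(1)]])
  moreover have "?r w = x * c" using r0(3) b(2) by (simp flip: mult.assoc)
  moreover have "x * c \<in> K" using x(1) xs(2) c(1) A_K by (intro division_subringD(4)[OF K]) auto
  ultimately show ?thesis using r0(2) x(2) by (intro bexI[of _ ?r]) auto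
qed

text \<open>Choosing the maps one after the other so that every later one annihilates all vectors
  visited before isolates the coefficient of a single monomial.\<close>

lemma staircase:
  fixes J :: "'i set"
  assumes infinite_dim: "\<And>V. finite V \<Longrightarrow> V \<subseteq> K \<Longrightarrow> \<not> K \<subseteq> lspan L V"
    and "finite J" and "finite T" and "T \<subseteq> K" and "w \<in> K" and "w \<notin> lspan L T"
    and "\<And>r. (\<And>i. r i \<in> bimaps L A) \<Longrightarrow> (\<And>i v. v \<in> T \<Longrightarrow> r i v = 0) \<Longrightarrow>
      (\<Sum>u\<in>permutations_of_set J. p u * foldl (\<lambda>x i. r i x) w u) = 0"
    and "u \<in> permutations_of_set J"
  shows "p u = 0"
  using assms(2-)
proof (induction J arbitrary: T w p u rule: finite_psubset_induct)
  case (psubset J)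
  show ?case
  proof (cases "J = {}")
    case True
    have "p [] * w = 0" using psubset.prems(5)[of "\<lambda>_ _. 0", OF bimaps_zero] True by simp
    moreover have "w \<noteq> 0" using psubset.prems(4) lspan_zero by blast
    ultimately show ?thesis using psubset.prems(6) True by simp
  next
    case False
    obtain i v where u: "u = i # v" "i \<in> J" "v \<in> permutations_of_set (J - {i})"
      using psubset.prems(6) unfolding permutations_of_set_nonempty[OF False] by blast
    obtain s where s: "s \<in> bimaps L A" "\<forall>v\<in>T. s v = 0" "s w \<in> K" "s w \<notin> lspan L (insert w T)"
      using escaping_bimap[OF infinite_dim psubset.prems(1-4)] by blast
    have "p (i # v) = 0"
    proof (rule psubset.IH[where p = "\<lambda>v. p (i # v)" and u = v, OF _ _ _ s(3,4)])
      show "J - {i} \<subset> J" using u(2) by blast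
      show "finite (insert w T)" "insert w T \<subseteq> K" using psubset.prems by auto
      show "v \<in> permutations_of_set (J - {i})" by (rule u(3))
    next
      fix r :: "'i \<Rightarrow> 'a \<Rightarrow> 'a"
      assume r: "\<And>i. r i \<in> bimaps L A" "\<And>i v. v \<in> insert w T \<Longrightarrow> r i v = 0"
      \<comment> \<open>All maps of \<open>?r\<close> except \<open>s\<close> annihilate
        \<open>w\<close>, so only words beginning with \<open>i\<close> survive; the rest of such a
        word avoids \<open>i\<close> and sees \<open>r\<close>.\<close>
      let ?r = "r(i := s)"
      have rA: "?r j \<in> bimaps L A" for j using r(1) s(1) by simp
      have fold: "foldl (\<lambda>x i. ?r i x) (?r j w) v = (if j = i then foldl (\<lambda>x i. r i x) (s w) v else 0)"
        if v: "v \<in> permutations_of_set (J - {j})" for j v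
      proof (cases "j = i")
        case True
        then have "i \<notin> set v" using permutations_of_setD(1)[OF v] by blast
        then have "foldl (\<lambda>x i. ?r i x) (s w) v = foldl (\<lambda>x i. r i x) (s w) v"
          by (rule foldl_fun_upd_notin)
        then show ?thesis using True by simp
      next
        case False
        then have "?r j w = 0" using r(2) by simp
        moreover have "foldl (\<lambda>x i. ?r i x) 0 v = 0"
          by (rule foldl_zero) (rule bimaps_additive(2)[OF rA])
        ultimately show ?thesis using False by simp
      qed
      have "0 = (\<Sum>u\<in>permutations_of_set J. p u * foldl (\<lambda>x i. ?r i x) w u)"
        by (rule psubset.prems(5)[symmetric, OF rA]) (use r(2) s(2) in auto)
      also have "\<dots> = (\<Sum>j\<in>J. \<Sum>v\<in>permutations_of_set (J - {j}).
          p (j # v) * foldl (\<lambda>x i. ?r i x) (?r j w) v)"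
        unfolding sum_permutations_of_set[OF psubset.hyps False] foldl.simps ..
      also have "\<dots> = (\<Sum>j\<in>J. if j = i then
          \<Sum>v\<in>permutations_of_set (J - {i}). p (i # v) * foldl (\<lambda>x i. r i x) (s w) v else 0)"
      proof (rule sum.cong[OF refl])
        fix j
        have "(\<Sum>v\<in>permutations_of_set (J - {j}). p (j # v) * foldl (\<lambda>x i. ?r i x) (?r j w) v) =
          (\<Sum>v\<in>permutations_of_set (J - {j}).
            p (j # v) * (if j = i then foldl (\<lambda>x i. r i x) (s w) v else 0))"
          by (rule sum.cong[OF refl]) (simp only: fold)
        then show "(\<Sum>v\<in>permutations_of_set (J - {j}). p (j # v) * foldl (\<lambda>x i. ?r i x) (?r j w) v) =
          (if j = i then \<Sum>v\<in>permutations_of_set (J - {i}).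
            p (i # v) * foldl (\<lambda>x i. r i x) (s w) v else 0)"
          by (cases "j = i") simp_all
      qed
      also have "\<dots> = (\<Sum>v\<in>permutations_of_set (J - {i}). p (i # v) * foldl (\<lambda>x i. r i x) (s w) v)"
        using u(2) psubset.hyps by simp
      finally show "(\<Sum>v\<in>permutations_of_set (J - {i}). p (i # v) * foldl (\<lambda>x i. r i x) (s w) v) = 0"
        by simp
    qed
    then show ?thesis using u by simp
  qed
qed

text \<open>In infinite dimension the staircase, started at \<open>1\<close> with nothing to
  annihilate, would force \<open>q u0 = 0\<close>.\<close>

lemma finite_dim: "\<exists>V. finite V \<and> V \<subseteq> K \<and> K \<subseteq> lspan L V"
proof (rule ccontr)
  assume "\<not> ?thesis"
  then have infinite_dim: "\<And>V. finite V \<Longrightarrow> V \<subseteq> K \<Longrightarrow> \<not> K \<subseteq> lspan L V" by blast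
  have "lspan L {} \<subseteq> {0}" unfolding lspan_def by (rule addcl_subset) auto
  then have "1 \<notin> lspan L {}" by auto
  then have "q u0 = 0"
    using bimaps_identity division_subringD(2)[OF K] u0(1)
    by (intro staircase[OF infinite_dim finite_I, of "{}" 1 q]) auto
  then show False using u0(2) by simp
qed

end

context multilinear_identity
begin

theorem generated_centrally_finite: "centrally_finite K"
proof -
  obtain L where "L = {x \<in> K. \<forall>l\<in>L. x * l = l * x}" by (rule maximal_commutative_exists)
  then interpret multilinear_identity_max K A I q u0 L
    by unfold_locales (rule K)
  show ?thesis using finite_dim centrally_finite_if_finite_dim by blast
qed

end

section \<open>Weakly locally finite division rings\<close>

lemma division_subring_UNIV: "division_subring UNIV"
  by (simp add: division_subring_def)

lemma division_subring_gen:
  shows division_subring_gen_closed: "division_subring (division_subring_gen S)"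
    and division_subring_gen_superset: "S \<subseteq> division_subring_gen S"
    and division_subring_gen_least:
      "division_subring K \<Longrightarrow> S \<subseteq> K \<Longrightarrow> division_subring_gen S \<subseteq> K"
  unfolding division_subring_gen_def division_subring_def by blast+

lemma subalg_gen_closed:
  "x \<in> subalg_gen F S \<Longrightarrow> y \<in> subalg_gen F S \<Longrightarrow> x + y \<in> subalg_gen F S"
  "x \<in> subalg_gen F S \<Longrightarrow> y \<in> subalg_gen F S \<Longrightarrow> x * y \<in> subalg_gen F S"
  unfolding subalg_gen_def by blast+

lemma subalg_gen_superset: "F \<union> S \<subseteq> subalg_gen F S"
  unfolding subalg_gen_def by blast

lemma subalg_gen_least:
  assumes "F \<subseteq> A" and "S \<subseteq> A" and "\<And>x y. x \<in> A \<Longrightarrow> y \<in> A \<Longrightarrow> x + y \<in> A"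
    and "\<And>x y. x \<in> A \<Longrightarrow> y \<in> A \<Longrightarrow> x * y \<in> A"
  shows "subalg_gen F S \<subseteq> A"
  unfolding subalg_gen_def by (rule Inter_lower) (simp add: assms)

text \<open>A finite spanning set \<open>B\<close> of \<open>K\<close> over its center also spans
  \<open>F K\<close> over products of central elements of the whole ring and of \<open>K\<close>.
  These commute with each other and with \<open>B\<close>.\<close>

lemma centrally_finite_standard_identity:
  fixes K :: "'a::division_ring set"
  assumes K: "division_subring K" and "centrally_finite K"
  obtains d where "\<And>y :: nat \<Rightarrow> 'a.
    (\<And>i. y i \<in> addcl {z * k |z k. z \<in> center_of UNIV \<and> k \<in> K}) \<Longrightarrow>
    (\<Sum>u\<in>permutations_of_set {..<d}. std_coeff d u * prod_list (map y u)) = 0"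
proof -
  obtain B where B: "finite B" "B \<subseteq> K" "K \<subseteq> lspan (center_of K) B"
    using assms(2) centrally_finite_iff[OF K] by blast
  let ?F = "center_of (UNIV :: 'a set)"
  let ?C = "{z * c |z c. z \<in> ?F \<and> c \<in> center_of K}"
  have F: "z * x = x * z" if "z \<in> ?F" for z x using that by (simp add: center_of_def)
  have Z: "c * x = x * c" "c \<in> K" if "c \<in> center_of K" "x \<in> K" for c x
    using that by (auto simp: center_of_def)
  have CK: "c * x = x * c" if cC: "c \<in> ?C" and x: "x \<in> K" for c x
  proof -
    obtain z c' where c: "c = z * c'" "z \<in> ?F" "c' \<in> center_of K" using cC by blast
    have "z * c' * x = z * x * c'" using Z(1)[OF c(3) x] by (simp only: mult.assoc)
    also have "\<dots> = x * z * c'" by (simp only: F[OF c(2)])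
    finally show ?thesis by (simp only: c(1) mult.assoc)
  qed
  have lspan_C: "z * k \<in> addcl {c * b |c b. c \<in> ?C \<and> b \<in> B}" if z: "z \<in> ?F" and "k \<in> K" for z k
  proof -
    have "k \<in> addcl {c * b |c b. c \<in> center_of K \<and> b \<in> B}"
      using B(3) \<open>k \<in> K\<close> by (auto simp: lspan_def)
    then show ?thesis
    proof (rule addcl_additive_image)
      fix x assume "x \<in> {c * b |c b. c \<in> center_of K \<and> b \<in> B}"
      then obtain c b where "x = c * b" "c \<in> center_of K" "b \<in> B" by blast
      then have "z * x = z * c * b" "z * c \<in> ?C" "b \<in> B" using z by (auto simp: mult.assoc)
      then show "z * x \<in> addcl {c * b |c b. c \<in> ?C \<and> b \<in> B}" by (intro addcl_base) blast
    qed (simp_all add: distrib_left)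
  qed
  show thesis
  \<comment> \<open>Degree one above \<open>card B\<close> forces a repetition among the elements of
    \<open>B\<close>.\<close>
  proof (rule that[of "Suc (card B)"])
    fix y :: "nat \<Rightarrow> 'a"
    assume y: "\<And>i. y i \<in> addcl {z * k |z k. z \<in> ?F \<and> k \<in> K}"
    show "(\<Sum>u\<in>permutations_of_set {..<Suc (card B)}. std_coeff (Suc (card B)) u * prod_list (map y u)) = 0"
    proof (rule standard_identity[where B = B and C = ?C])
      show "?C \<noteq> {}"
        using division_subringD(1)[OF center_of_division_subring[OF K]]
          division_subringD(1)[OF center_of_division_subring[OF division_subring_UNIV]] by blast
      show "B \<noteq> {}"
      proof
        assume "B = {}"
        then have "lspan (center_of K) B \<subseteq> {0}" unfolding lspan_def by (intro addcl_subset) auto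
        then show False using B(3) division_subringD(2)[OF K] by auto
      qed
      show "c * b = b * c" if "c \<in> ?C" "b \<in> B" for c b using CK that B(2) by blast
      show "c * c' = c' * c" if c: "c \<in> ?C" "c' \<in> ?C" for c c'
      proof -
        obtain z x where x: "c' = z * x" "z \<in> ?F" "x \<in> center_of K" using c(2) by blast
        have xK: "x \<in> K" using x(3) by (simp add: center_of_def)
        have "c * (z * x) = z * (c * x)" using F[OF x(2)] by (metis mult.assoc)
        also have "\<dots> = z * x * c" using CK[OF c(1) xK] by (simp add: mult.assoc)
        finally show ?thesis by (simp only: x(1))
      qed
      show "y i \<in> addcl {c * b |c b. c \<in> ?C \<and> b \<in> B}" for i
        by (rule addcl_additive_image[OF y, where h = "\<lambda>x. x"]) (use lspan_C in auto)
    qed (use B in auto)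
  qed
qed

lemma weakly_locally_finite_imp_locally_PI:
  assumes "weakly_locally_finite TYPE('a::division_ring)"
  shows "locally_PI TYPE('a)"
  unfolding locally_PI_def
proof (intro allI impI)
  fix S :: "'a set" assume "finite S"
  let ?F = "center_of (UNIV :: 'a set)"
  have F: "division_subring ?F" by (rule center_of_division_subring[OF division_subring_UNIV])
  define K where "K = division_subring_gen S"
  have K: "division_subring K" unfolding K_def by (rule division_subring_gen_closed)
  have "centrally_finite K"
    using assms \<open>finite S\<close> unfolding weakly_locally_finite_def K_def by blast
  \<comment> \<open>This is \<open>F K\<close>; as \<open>F\<close> is central, it is closed under
    products and contains \<open>F[S]\<close>.\<close>
  let ?M = "addcl {z * k |z k. z \<in> ?F \<and> k \<in> K}"
  obtain d where std: "\<And>y :: nat \<Rightarrow> 'a. (\<And>i. y i \<in> ?M) \<Longrightarrow>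
      (\<Sum>u\<in>permutations_of_set {..<d}. std_coeff d u * prod_list (map y u)) = 0"
    using centrally_finite_standard_identity[OF K \<open>centrally_finite K\<close>] by blast
  have base: "z * k \<in> ?M" if "z \<in> ?F" "k \<in> K" for z k
    using that by (intro addcl_base) blast
  have M: "subalg_gen ?F S \<subseteq> ?M"
  proof (rule subalg_gen_least)
    show "?F \<subseteq> ?M" using base[OF _ division_subringD(2)[OF K]] by auto
    show "S \<subseteq> ?M"
      using base[OF division_subringD(2)[OF F]] division_subring_gen_superset[of S] by (auto simp: K_def)
    show "x + y \<in> ?M" if "x \<in> ?M" "y \<in> ?M" for x y using that by (rule addcl_add)
    show "x * y \<in> ?M" if "x \<in> ?M" "y \<in> ?M" for x y
    proof (rule addcl_mult_closed[OF _ that])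
      fix x y assume "x \<in> {z * k |z k. z \<in> ?F \<and> k \<in> K}" "y \<in> {z * k |z k. z \<in> ?F \<and> k \<in> K}"
      then obtain z k z' k' where xy: "x = z * k" "y = z' * k'" "z \<in> ?F" "k \<in> K" "z' \<in> ?F" "k' \<in> K"
        by blast
      have "z' * k = k * z'" using xy(5) by (simp add: center_of_def)
      then have "x * y = z * z' * (k * k')" unfolding xy(1,2) by (metis mult.assoc)
      then show "x * y \<in> ?M"
        using base[OF division_subringD(4)[OF F xy(3,5)] division_subringD(4)[OF K xy(4,6)]] by simp
    qed
  qed
  \<comment> \<open>The standard polynomial, extended by zero. Its coefficients \<open>1\<close> and
    \<open>-1\<close> are nonzero and lie in \<open>F\<close>, so its support consists of all
    permutations.\<close>
  define p :: "nat list \<Rightarrow> 'a" where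
    "p u = (if u \<in> permutations_of_set {..<d} then std_coeff d u else 0)" for u
  have supp: "{u. p u \<noteq> 0} = permutations_of_set {..<d}"
    using std_coeff_cases[where 'a = 'a and d = d] by (auto simp: p_def) (metis neg_equal_0_iff_equal zero_neq_one)
  have "p u \<in> ?F" for u
    using std_coeff_cases[where 'a = 'a and d = d, of u] division_subringD(1,2,5)[OF F]
    by (auto simp: p_def simp del: of_int_eq_1_iff)
  then have "is_ncpoly ?F p" by (simp add: is_ncpoly_def supp)
  moreover have "\<exists>w. p w \<noteq> 0"
    using supp permutations_of_set_empty_iff[of "{..<d}"] by blast
  moreover have "ncpoly_eval p a = 0" if "\<And>i. a i \<in> subalg_gen ?F S" for a
    using std[of a] M that unfolding ncpoly_eval_def supp by (simp add: p_def subset_iff)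
  ultimately show "satisfies_PI ?F (subalg_gen ?F S)"
    unfolding satisfies_PI_def by blast
qed

lemma locally_PI_imp_weakly_locally_finite:
  assumes "locally_PI TYPE('a::division_ring)"
  shows "weakly_locally_finite TYPE('a)"
  unfolding weakly_locally_finite_def
proof (intro allI impI)
  fix S :: "'a set" assume "finite S"
  let ?F = "center_of (UNIV :: 'a set)"
  have F: "division_subring ?F" by (rule center_of_division_subring[OF division_subring_UNIV])
  define A where "A = subalg_gen ?F S"
  define Q where "Q = division_subring_gen (?F \<union> S)"
  define K where "K = division_subring_gen S"
  have FSA: "?F \<union> S \<subseteq> A" unfolding A_def by (rule subalg_gen_superset)
  have Q: "division_subring Q" "?F \<union> S \<subseteq> Q"
    unfolding Q_def by (rule division_subring_gen_closed division_subring_gen_superset)+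
  have K: "division_subring K" unfolding K_def by (rule division_subring_gen_closed)
  have A_closed: "x + y \<in> A" "x * y \<in> A" if "x \<in> A" "y \<in> A" for x y
    using that subalg_gen_closed unfolding A_def by blast+
  \<comment> \<open>Having \<open>-1\<close> in \<open>F\<close> supplies the negatives, since
    \<open>subalg_gen\<close> only demands closure under sums and products.\<close>
  have A01: "0 \<in> A" "1 \<in> A" "-1 \<in> A" using FSA division_subringD(1,2,5)[OF F] by blast+
  have A_add: "\<forall>x\<in>A. \<forall>y\<in>A. x + y \<in> A" using A_closed(1) by blast
  have PI: "satisfies_PI ?F A" using assms \<open>finite S\<close> unfolding locally_PI_def A_def by blast
  obtain d :: nat and q u0 where q: "\<forall>u. q u \<in> ?F" "u0 \<in> permutations_of_set {..<d}" "q u0 \<noteq> 0"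
    "\<forall>y. (\<forall>i. y i \<in> A) \<longrightarrow> (\<Sum>u\<in>permutations_of_set {..<d}. q u * prod_list (map y u)) = 0"
    using satisfies_PI_multilinear[OF PI A01(1) A_add] by (elim exE conjE)
  \<comment> \<open>The coefficients \<open>q u\<close> lie in \<open>F\<close>, hence both in
    \<open>A\<close> and in the center; \<open>F\<close> and \<open>S\<close> are contained in
    \<open>A\<close>, so \<open>A\<close> generates \<open>Q\<close>.\<close>
  interpret Q: multilinear_identity Q A "{..<d}" q u0
  proof
    show "A \<subseteq> Q"
      unfolding A_def by (rule subalg_gen_least) (use Q division_subringD(3,4)[OF Q(1)] in auto)
    show "- x \<in> A" if "x \<in> A" for x using A_closed(2)[OF A01(3) that] by simp
    show "Q \<subseteq> K'" if "division_subring K'" "A \<subseteq> K'" for K'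
      unfolding Q_def using that FSA by (intro division_subring_gen_least) auto
    show "q u \<in> A" for u using q(1) FSA by blast
    show "q u * x = x * q u" for u x using q(1) by (simp add: center_of_def)
  qed (use Q q A01 A_closed in auto)
  obtain e where std: "\<And>y :: nat \<Rightarrow> 'a. (\<And>i. y i \<in> addcl {z * k |z k. z \<in> ?F \<and> k \<in> Q}) \<Longrightarrow>
      (\<Sum>u\<in>permutations_of_set {..<e}. std_coeff e u * prod_list (map y u)) = 0"
    using centrally_finite_standard_identity[OF Q(1) Q.generated_centrally_finite] by blast
  have KQ: "K \<subseteq> Q" unfolding K_def by (rule division_subring_gen_least) (use Q in auto)
  \<comment> \<open>The identity of \<open>A\<close> has coefficients in \<open>F\<close>, which \<open>K\<close> need not contain;
    the standard identity of \<open>Q\<close> restricts to \<open>K\<close>.\<close>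
  interpret K: multilinear_identity K K "{..<e}" "std_coeff e" "[0..<e]"
  proof
    show "std_coeff e u \<in> K" for u
      using std_coeff_cases[where 'a = 'a and d = e, of u] division_subringD(2,5)[OF K] by auto
    show "std_coeff e u * x = x * std_coeff e u" for u x by (rule mult_of_int_commute)
    show "[0..<e] \<in> permutations_of_set {..<e}" by (auto simp: permutations_of_set_def)
    show "std_coeff e [0..<e] \<noteq> (0 :: 'a)"
      using std_coeff_cases[where 'a = 'a and d = e, of "[0..<e]"] by auto
    show "(\<Sum>u\<in>permutations_of_set {..<e}. std_coeff e u * prod_list (map y u)) = 0"
      if "\<And>i. y i \<in> K" for y :: "nat \<Rightarrow> 'a"
    proof (rule std)
      fix i
      have "1 * y i \<in> addcl {z * k |z k. z \<in> ?F \<and> k \<in> Q}"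
        using that KQ division_subringD(2)[OF F] by (intro addcl_base) blast
      then show "y i \<in> addcl {z * k |z k. z \<in> ?F \<and> k \<in> Q}" by simp
    qed
  qed (use K division_subringD[OF K] in auto)
  show "centrally_finite (division_subring_gen S)"
    using K.generated_centrally_finite unfolding K_def .
qed

theorem theorem2p2:
  shows "weakly_locally_finite TYPE('a::division_ring) \<longleftrightarrow> locally_PI TYPE('a)"
  using weakly_locally_finite_imp_locally_PI locally_PI_imp_weakly_locally_finite by blast

end
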